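(* Let $k\ge 1$ and let $1\le s_1<s_2<\ldots<s_k$ be fixed integers. For each integer $n>s_k$, let $f_{G}(n)$ be the number of rooted spanning forests in the circulant graph $G=C_{2n}(s_1,s_2,\ldots,s_k,n)$. Then $$f_{G}(n)\sim K^{n}\quad\text{as } n\to\infty,$$ where $K=\exp\left(\int_0^1\log(P^{2}(e^{2\pi i t})-1)\,dt\right)$ is the Mahler measure of the Laurent polynomial $(P(z)-1)(P(z)+1)$, with $P(z)=2k+2-\sum_{i=1}^k(z^{s_i}+z^{-s_i})$.
   Context: The circulant graph $C_{m}(t_1,\ldots,t_l)$ (with $1\le t_1<\ldots<t_l\le \frac m2$) is the simple undirected graph with vertices $0,1,\ldots,m-1$ in which each vertex $i$ is adjacent to the vertices $i\pm t_1,\ldots,i\pm t_l \pmod m$. In particular, in $C_{2n}(s_1,\ldots,s_k,n)$ each vertex $i$ is adjacent to $i\pm s_1,\ldots,i\pm s_k$ and, by a single edge, to $i+n \pmod{2n}$, so every vertex has degree $2k+1$. A rooted spanning forest of a graph is a spanning acyclic subgraph (containing all the vertices) together with a choice of one distinguished vertex (root) in each connected component. The Mahler measure of a Laurent polynomial $R(z)=a_s z^{m}\prod_{i=1}^{s}(z-\alpha_i)$ with complex coefficients ($a_s\ne 0$, $m\in\mathbb{Z}$) is $M(R)=\exp\left(\int_0^1\log|R(e^{2\pi i t})|\,dt\right)$, equivalently $M(R)=|a_s|\prod_{|\alpha_i|>1}|\alpha_i|$. The notation $f(n)\sim g(n)$ means $f(n)/g(n)\to 1$ as $n\to\infty$.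 *)

theory Defs
  imports
    "HOL-Analysis.Analysis"
    "HOL-Library.Poly_Mapping"
    "HOL-Library.Landau_Symbols"
begin

unbundle asymp_equiv_syntax

section \<open>Simple undirected graphs and rooted spanning forests\<close>

text \<open>
  An edge is the set of its two end points, so that there are no multiple edges.
\<close>

record 'a ugraph =
  uverts :: "'a set"
  uedges :: "'a set set"

definition uspanning_subgraph :: "'a ugraph \<Rightarrow> 'a ugraph \<Rightarrow> bool" where
  "uspanning_subgraph H G \<longleftrightarrow> uverts H = uverts G \<and> uedges H \<subseteq> uedges G"

definition ucycle :: "'a ugraph \<Rightarrow> 'a list \<Rightarrow> bool" where
  "ucycle G xs \<longleftrightarrow> 3 \<le> length xs \<and> distinct xs \<and>
     (\<forall>i<length xs. {xs ! i, xs ! (Suc i mod length xs)} \<in> uedges G)"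

definition uacyclic :: "'a ugraph \<Rightarrow> bool" where
  "uacyclic G \<longleftrightarrow> (\<nexists>xs. ucycle G xs)"

definition ucomponents :: "'a ugraph \<Rightarrow> 'a set set" where
  "ucomponents G = (\<lambda>u. {v. (u, v) \<in> {(x, y). {x, y} \<in> uedges G}\<^sup>*}) ` uverts G"

text \<open>A rooted spanning forest is a spanning forest together with its set of roots.\<close>

definition rooted_spanning_forests :: "'a ugraph \<Rightarrow> ('a ugraph \<times> 'a set) set" where
  "rooted_spanning_forests G =
     {(H, R). uspanning_subgraph H G \<and> uacyclic H \<and>
              R \<subseteq> uverts H \<and> (\<forall>C\<in>ucomponents H. \<exists>!r. r \<in> C \<and> r \<in> R)}"

text \<open>
  The circulant graph on \<open>m\<close> vertices with set of jumps \<open>T\<close>, which is meant for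
  \<open>1 \<le> t \<le> m / 2\<close> for all \<open>t \<in> T\<close>; under this condition there are no loops.
  A jump \<open>t = m / 2\<close> yields a single edge, as the two neighbours \<open>i + t\<close> and \<open>i - t\<close>
  coincide modulo \<open>m\<close>.
\<close>

definition circulant :: "nat \<Rightarrow> nat set \<Rightarrow> nat ugraph" where
  "circulant m T =
     \<lparr>uverts = {..<m},
      uedges = {{i, j} | i j. i < m \<and> j < m \<and>
        (\<exists>t\<in>T. int j = (int i + int t) mod int m \<or> int j = (int i - int t) mod int m)}\<rparr>"


section \<open>Laurent polynomials and Mahler measure\<close>

text \<open>
  Finitely supported functions \<open>int \<Rightarrow>\<^sub>0 complex\<close> with the convolution product form the
  ring of complex Laurent polynomials; \<open>Poly_Mapping.single j c\<close> is the monomial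
  \<open>c z\<^sup>j\<close>.
\<close>

type_synonym laurent = "int \<Rightarrow>\<^sub>0 complex"

definition laurent_eval :: "laurent \<Rightarrow> complex \<Rightarrow> complex" where
  "laurent_eval R z = (\<Sum>j\<in>Poly_Mapping.keys R. Poly_Mapping.lookup R j * z powi j)"

text \<open>
  For \<open>R \<noteq> 0\<close> the integrand is undefined at finitely many points only, where the value
  of \<^const>\<open>ln\<close> is immaterial.
\<close>

definition mahler_measure :: "laurent \<Rightarrow> real" where
  "mahler_measure R = exp (integral {0..1} (\<lambda>t. ln (cmod (laurent_eval R (cis (2 * pi * t))))))"

definition jump_laurent :: "nat \<Rightarrow> (nat \<Rightarrow> nat) \<Rightarrow> laurent" where
  "jump_laurent k s = Poly_Mapping.single 0 (of_nat (2 * k + 2)) -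
     (\<Sum>i = 1..k. Poly_Mapping.single (int (s i)) 1 + Poly_Mapping.single (- int (s i)) 1)"

end

theory Submission
  imports
    Defs
    "Jordan_Normal_Form.Determinant"
    "HOL-Library.Real_Mod"
begin

text \<open>
  The number of rooted spanning forests of a finite graph is the determinant of
  \<open>I + L\<close>, where \<open>L\<close> is the Laplacian (\<open>det_forest_matrix\<close>).  For a circulant graph
  this matrix is circulant, so the discrete Fourier basis diagonalises it.  With
  \<open>P(e\<^bsup>2 \<pi> i t\<^esup>) = 2 k + 2 - S(t)\<close> and \<open>S(t) = \<Sum>\<^sub>i 2 cos (2 \<pi> s\<^sub>i t)\<close>, the eigenvalues of \<open>I + L\<close> for
  \<open>C\<^bsub>2n\<^esub>(s\<^sub>1, \<dots>, s\<^sub>k, n)\<close> are the numbers \<open>P(\<omega>\<^sup>l) - (-1)\<^sup>l\<close>, where \<open>\<omega>\<close> is a primitive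
  \<open>2n\<close>-th root of unity.  Even \<open>l\<close> give \<open>P - 1\<close> at the points \<open>t = j / n\<close>, and odd \<open>l\<close> give
  \<open>P + 1\<close> at the points \<open>t = (j + 1/2) / n\<close>
  (\<open>card_rooted_spanning_forests_even_circulant\<close>).

  The logarithm of the number of forests is therefore \<open>n\<close> times a Riemann sum of
  \<open>ln (P - 1)\<close> plus \<open>n\<close> times a shifted Riemann sum of \<open>ln (P + 1)\<close>, and
  \<open>n ln K\<close> is \<open>n\<close> times the sum of the two integrals.  An asymptotic equivalence, as opposed to
  equality of growth rates, needs the errors of the Riemann sums to be \<open>o(1/n)\<close>.
  They even decay exponentially (\<open>equispaced_ln_tendsto_integral\<close>): as \<open>\<bar>S\<bar> \<le> 2 k\<close> is smaller
  than \<open>2 k + 1\<close> and \<open>2 k + 3\<close>, the power series of the logarithm approximates the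
  integrands uniformly and geometrically fast by polynomials in \<open>S\<close>.  These are
  trigonometric polynomials, for which the average over \<open>n\<close> equispaced points equals the
  integral as soon as \<open>n\<close> exceeds the degree.

  The matrix theorem comes from expanding \<open>det (I + L)\<close> by multilinearity in the rows.
  Row \<open>v\<close> is the sum of \<open>e\<^sub>v\<close> and of the vectors \<open>e\<^sub>v - e\<^sub>w\<close> for the neighbours \<open>w\<close> of \<open>v\<close>, so
  a term of the expansion chooses for every vertex either a parent among its
  neighbours or to be a root.  The term is \<open>1\<close> if every vertex has a root among its ancestors
  and \<open>0\<close> otherwise, and the choices of the first kind are exactly the rooted spanning forests.
\<close>

section \<open>Acyclicity and bridges\<close>

definition adj_rel :: "'a set set \<Rightarrow> ('a \<times> 'a) set" where
  "adj_rel E = {(x, y). {x, y} \<in> E}"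

lemma sym_adj_rel: "sym (adj_rel E)"
  by (auto simp: sym_def adj_rel_def insert_commute)

lemma adj_rel_rtrancl_sym: "(u, v) \<in> (adj_rel E)\<^sup>* \<Longrightarrow> (v, u) \<in> (adj_rel E)\<^sup>*"
  by (rule symD[OF sym_rtrancl[OF sym_adj_rel]])

lemma adj_rel_mono: "E \<subseteq> F \<Longrightarrow> adj_rel E \<subseteq> adj_rel F"
  by (auto simp: adj_rel_def)

text \<open>
  Prepending a vertex to a path without repetitions keeps it so, or else the path is cut
  back to the occurrence of that vertex.
\<close>

lemma rtrancl_distinct_path:
  assumes "(u, v) \<in> (adj_rel E)\<^sup>*"
  shows "\<exists>xs. xs \<noteq> [] \<and> hd xs = u \<and> last xs = v \<and> distinct xs \<and>
           (\<forall>i. Suc i < length xs \<longrightarrow> {xs ! i, xs ! Suc i} \<in> E)"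
  using assms
proof (induction rule: converse_rtrancl_induct)
  case base
  show ?case by (rule exI[of _ "[v]"]) auto
next
  case (step u w)
  then obtain xs where xs: "xs \<noteq> []" "hd xs = w" "last xs = v" "distinct xs"
    and E: "\<And>i. Suc i < length xs \<Longrightarrow> {xs ! i, xs ! Suc i} \<in> E" by auto
  show ?case
  proof (cases "u \<in> set xs")
    case True
    then obtain ys zs where yz: "xs = ys @ u # zs" by (meson split_list)
    have "{(u # zs) ! i, (u # zs) ! Suc i} \<in> E" if "Suc i < length (u # zs)" for i
      using E[of "length ys + i"] that unfolding yz by (simp add: nth_append)
    then show ?thesis using xs yz by (intro exI[of _ "u # zs"]) auto
  next
    case False
    have "{(u # xs) ! i, (u # xs) ! Suc i} \<in> E" if "Suc i < length (u # xs)" for i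
      using that xs step.hyps(1) E[of "i - 1"]
      by (cases i) (auto simp: hd_conv_nth adj_rel_def)
    then show ?thesis using xs False by (intro exI[of _ "u # xs"]) auto
  qed
qed

text \<open>
  Cycles given as vertex lists are inconvenient when edges are described by a parent function.
  The condition that no edge can be bypassed is about reachability only: closing a
  repetition-free detour around an edge by that edge gives a cycle, and a cycle minus an edge is a detour.
\<close>

lemma uacyclic_iff_bridges:
  assumes "\<And>v. {v} \<notin> uedges H"
  shows "uacyclic H \<longleftrightarrow>
    (\<forall>u v. {u, v} \<in> uedges H \<longrightarrow> (u, v) \<notin> (adj_rel (uedges H - {{u, v}}))\<^sup>*)"
proof (intro iffI allI impI notI)
  fix u v
  assume ac: "uacyclic H" and e: "{u, v} \<in> uedges H"
    and "(u, v) \<in> (adj_rel (uedges H - {{u, v}}))\<^sup>*"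
  then obtain xs where xs: "xs \<noteq> []" "hd xs = u" "last xs = v" "distinct xs"
    and E: "\<And>i. Suc i < length xs \<Longrightarrow> {xs ! i, xs ! Suc i} \<in> uedges H - {{u, v}}"
    using rtrancl_distinct_path by metis
  have "u \<noteq> v" using assms[of u] e by auto
  have h: "xs ! 0 = u" "xs ! (length xs - 1) = v" using xs by (auto simp: hd_conv_nth last_conv_nth)
  \<comment> \<open>A detour of a single edge would be the removed edge itself, so the closed path has at least three vertices.\<close>
  then have "length xs \<noteq> 1" using \<open>u \<noteq> v\<close> by auto
  moreover have "length xs \<noteq> 2" using h E[of 0] by auto
  moreover have "length xs \<noteq> 0" using xs by auto
  ultimately have len: "length xs \<ge> 3" by linarith
  have "{xs ! i, xs ! (Suc i mod length xs)} \<in> uedges H" if "i < length xs" for i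
  proof (cases "Suc i < length xs")
    case False
    then have i: "Suc i = length xs" "i = length xs - 1" using that by auto
    show ?thesis unfolding i(1) using h i(2) e by (simp add: insert_commute)
  qed (use E in auto)
  then have "ucycle H xs" using len xs by (auto simp: ucycle_def)
  then show False using ac by (auto simp: uacyclic_def)
next
  assume br: "\<forall>u v. {u, v} \<in> uedges H \<longrightarrow> (u, v) \<notin> (adj_rel (uedges H - {{u, v}}))\<^sup>*"
  show "uacyclic H"
    unfolding uacyclic_def
  proof (rule notI, elim exE)
    fix xs assume "ucycle H xs"
    then have len: "3 \<le> length xs" and dis: "distinct xs"
      and E: "\<And>i. i < length xs \<Longrightarrow> {xs ! i, xs ! (Suc i mod length xs)} \<in> uedges H"
      by (auto simp: ucycle_def)
    define e where "e = {xs ! (length xs - 1), xs ! 0}"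
    have e: "e \<in> uedges H" 
    proof -
      have "Suc (length xs - 1) = length xs" using len by linarith
      then show ?thesis using E[of "length xs - 1"] len by (simp add: e_def)
    qed
    have "(xs ! 0, xs ! i) \<in> (adj_rel (uedges H - {e}))\<^sup>*" if "i < length xs" for i
      using that
    proof (induction i)
      case (Suc i)
      have "{xs ! i, xs ! Suc i} \<noteq> e"
      proof -
        have nth_inj: "xs ! a = xs ! b \<longleftrightarrow> a = b" if "a < length xs" "b < length xs" for a b
          using nth_eq_iff_index_eq[OF dis that] .
        have bounds: "0 < length xs" "length xs - 1 < length xs" "i < length xs" "Suc i < length xs"
          using len Suc.prems by auto
        have "xs ! Suc i \<noteq> xs ! 0"
          using nth_inj bounds by simp
        moreover have "\<not> (i = 0 \<and> Suc i = length xs - 1)" using len by auto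
        then have "\<not> (xs ! i = xs ! 0 \<and> xs ! Suc i = xs ! (length xs - 1))"
          using nth_inj[OF bounds(3,1)] nth_inj[OF bounds(4,2)] by simp
        ultimately show ?thesis by (auto simp: e_def doubleton_eq_iff)
      qed
      then have "(xs ! i, xs ! Suc i) \<in> adj_rel (uedges H - {e})"
        using E[of i] Suc.prems by (auto simp: adj_rel_def)
      then show ?case using Suc by (meson Suc_lessD rtrancl.rtrancl_into_rtrancl)
    qed simp
    from this[of "length xs - 1"] have "(xs ! 0, xs ! (length xs - 1)) \<in> (adj_rel (uedges H - {e}))\<^sup>*"
      using len by auto
    moreover have "e = {xs ! 0, xs ! (length xs - 1)}" by (auto simp: e_def)
    ultimately show False using br e by metis
  qed
qed

section \<open>Rooted forests as parent functions\<close>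

text \<open>
  In a parent function the roots are the fixed points, which avoids an option type; this
  is unambiguous because the graphs have no loops.
\<close>

definition rooted :: "('a \<Rightarrow> 'a) \<Rightarrow> 'a \<Rightarrow> bool" where
  "rooted p v \<longleftrightarrow> (\<exists>n. p ((p ^^ n) v) = (p ^^ n) v)"

lemma funpow_fixpoint: "p r = r \<Longrightarrow> (p ^^ n) r = r"
  by (induction n) auto

text \<open>
  Going round the cycle often enough passes the point at which the iteration has become
  stationary.
\<close>

lemma periodic_imp_fixpoint:
  assumes "rooted p w" and "(p ^^ Suc i) w = w"
  shows "p w = w"
proof -
  obtain n where n: "p ((p ^^ n) w) = (p ^^ n) w" using assms(1) by (auto simp: rooted_def)
  have "(p ^^ (Suc i * n)) w = w"
    using assms(2) by (induction n) (simp_all add: funpow_add)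
  moreover have "(p ^^ (Suc i * n)) w = (p ^^ n) w"
  proof -
    have "Suc i * n = i * n + n" by simp
    then show ?thesis using funpow_fixpoint[of p "(p ^^ n) w" "i * n", OF n] by (simp only: funpow_add o_apply)
  qed
  ultimately show ?thesis using n by simp
qed

lemma rooted_parent_iff: "rooted p (p v) \<longleftrightarrow> rooted p v"
proof
  assume "rooted p (p v)"
  then obtain n where "p ((p ^^ n) (p v)) = (p ^^ n) (p v)" by (auto simp: rooted_def)
  then have "p ((p ^^ Suc n) v) = (p ^^ Suc n) v" by (simp add: funpow_swap1)
  then show "rooted p v" unfolding rooted_def by blast
next
  assume "rooted p v"
  then obtain n where "p ((p ^^ n) v) = (p ^^ n) v" by (auto simp: rooted_def)
  then have "p ((p ^^ n) (p v)) = (p ^^ n) (p v)" by (metis funpow_swap1)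
  then show "rooted p (p v)" unfolding rooted_def by blast
qed

lemma reaches_root_parent_iff:
  assumes "p r = r"
  shows "(\<exists>n. (p ^^ n) (p v) = r) \<longleftrightarrow> (\<exists>n. (p ^^ n) v = r)"
proof
  assume "\<exists>n. (p ^^ n) (p v) = r"
  then show "\<exists>n. (p ^^ n) v = r" by (metis funpow_simps_right(2) o_apply)
next
  assume "\<exists>n. (p ^^ n) v = r"
  then obtain n where "(p ^^ n) v = r" by auto
  then have "(p ^^ n) (p v) = r" using assms by (metis funpow_swap1)
  then show "\<exists>n. (p ^^ n) (p v) = r" by auto
qed

locale finite_ugraph =
  fixes G :: "'a ugraph"
  assumes finite_verts: "finite (uverts G)"
    and edge_ends: "{u, v} \<in> uedges G \<Longrightarrow> u \<in> uverts G \<and> v \<in> uverts G \<and> u \<noteq> v"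
    and edge_doubleton: "e \<in> uedges G \<Longrightarrow> \<exists>u v. e = {u, v}"
begin

abbreviation "V \<equiv> uverts G"

definition nbrs :: "'a \<Rightarrow> 'a set" where
  "nbrs v = {w. {v, w} \<in> uedges G}"

lemma nbrs_subset: "nbrs v \<subseteq> V"
  and finite_nbrs: "finite (nbrs v)"
  and not_in_nbrs: "v \<notin> nbrs v"
proof -
  show "nbrs v \<subseteq> V" using edge_ends by (auto simp: nbrs_def)
  then show "finite (nbrs v)" using finite_verts by (rule finite_subset)
  show "v \<notin> nbrs v" using edge_ends[of v v] by (auto simp: nbrs_def)
qed

definition parent_choices :: "('a \<Rightarrow> 'a) set" where
  "parent_choices = (\<Pi>\<^sub>E v\<in>V. insert v (nbrs v))"

definition parent_functions :: "('a \<Rightarrow> 'a) set" where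
  "parent_functions = {p \<in> parent_choices. \<forall>v\<in>V. rooted p v}"

definition parent_edges :: "('a \<Rightarrow> 'a) \<Rightarrow> 'a set set" where
  "parent_edges p = {{v, p v} | v. v \<in> V \<and> p v \<noteq> v}"

definition forest_of :: "('a \<Rightarrow> 'a) \<Rightarrow> 'a ugraph \<times> 'a set" where
  "forest_of p = (\<lparr>uverts = V, uedges = parent_edges p\<rparr>, {v \<in> V. p v = v})"

lemma choices_closed: "p \<in> parent_choices \<Longrightarrow> v \<in> V \<Longrightarrow> p v \<in> V"
  using nbrs_subset by (fastforce simp: parent_choices_def PiE_def Pi_def)

lemma funpow_closed: "p \<in> parent_choices \<Longrightarrow> v \<in> V \<Longrightarrow> (p ^^ n) v \<in> V"
  by (induction n) (auto simp: choices_closed)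

lemma finite_parent_choices: "finite parent_choices"
  unfolding parent_choices_def using finite_verts finite_nbrs by (intro finite_PiE) auto

lemma parent_edge_in: "p \<in> parent_choices \<Longrightarrow> v \<in> V \<Longrightarrow> p v \<noteq> v \<Longrightarrow> {v, p v} \<in> uedges G"
  by (fastforce simp: parent_choices_def PiE_def Pi_def nbrs_def)

lemma parent_edges_subset: "p \<in> parent_choices \<Longrightarrow> parent_edges p \<subseteq> uedges G"
  using parent_edge_in by (auto simp: parent_edges_def)

lemma ancestor_connected:
  assumes "p \<in> parent_choices" "v \<in> V"
  shows "(v, (p ^^ n) v) \<in> (adj_rel (parent_edges p))\<^sup>*"
proof (induction n)
  case (Suc n)
  have "((p ^^ n) v, p ((p ^^ n) v)) \<in> (adj_rel (parent_edges p))\<^sup>*"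
    using funpow_closed[OF assms, of n]
    by (cases "p ((p ^^ n) v) = (p ^^ n) v") (auto simp: adj_rel_def parent_edges_def)
  with Suc show ?case by (auto intro: rtrancl_trans)
qed simp

text \<open>
  The root of a vertex is constant on connected components, since it is the same for a vertex
  and its parent.
\<close>

lemma reaches_root_connected:
  assumes "(u, v) \<in> (adj_rel (parent_edges p))\<^sup>*" "p r = r" "(p ^^ n) u = r"
  shows "\<exists>n. (p ^^ n) v = r"
  using assms(1)
proof (induction rule: rtrancl_induct)
  case base
  show ?case using assms by auto
next
  case (step x y)
  then have "y = p x \<or> x = p y"
    by (auto simp: adj_rel_def parent_edges_def doubleton_eq_iff)
  then show ?case using step reaches_root_parent_iff[of p r] assms(2) by metis
qed

text \<open>
  If the edge from \<open>w\<close> to its parent could be bypassed, then the bypass would stay among the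
  descendants of \<open>w\<close>: only the removed edge leads out of this set.  So the parent of \<open>w\<close>
  would be a descendant of \<open>w\<close>, which contradicts that \<open>w\<close> has a root among its ancestors.
\<close>

lemma forest_of_in_forests:
  assumes "p \<in> parent_functions"
  shows "forest_of p \<in> rooted_spanning_forests G"
proof -
  have pc: "p \<in> parent_choices" and rt: "\<And>v. v \<in> V \<Longrightarrow> rooted p v"
    using assms by (auto simp: parent_functions_def)
  let ?H = "\<lparr>uverts = V, uedges = parent_edges p\<rparr>"
  have noloop: "{v} \<notin> uedges ?H" for v
    using edge_ends[of v v] parent_edges_subset[OF pc] by auto
  have bridge: "(w, p w) \<notin> (adj_rel (parent_edges p - {{w, p w}}))\<^sup>*"
    if w: "w \<in> V" "p w \<noteq> w" for w
  proof
    assume "(w, p w) \<in> (adj_rel (parent_edges p - {{w, p w}}))\<^sup>*"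
    then have "\<exists>i. (p ^^ i) (p w) = w"
    proof (induction rule: rtrancl_induct)
      case base
      show ?case by (rule exI[of _ 0]) simp
    next
      case (step x y)
      then obtain i where i: "(p ^^ i) x = w" by auto
      have xy: "{x, y} \<in> parent_edges p" "{x, y} \<noteq> {w, p w}"
        using step.hyps(2) by (auto simp: adj_rel_def)
      show ?case
      proof (cases "y = p x")
        case True
        then have "x \<noteq> w" using xy(2) by auto
        then obtain j where "i = Suc j" using i by (cases i) auto
        then show ?thesis using i True by (auto simp: funpow_swap1)
      next
        case False
        then have "x = p y" using xy(1) by (auto simp: parent_edges_def doubleton_eq_iff)
        then have "(p ^^ Suc i) y = w" using i by (simp add: funpow_swap1)
        then show ?thesis by blast
      qed
    qed
    then obtain i where "(p ^^ i) (p w) = w" by auto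
    then have "(p ^^ Suc i) w = w" by (simp add: funpow_swap1)
    then show False using periodic_imp_fixpoint[OF rt[OF w(1)]] w(2) by blast
  qed
  have ac: "uacyclic ?H"
    unfolding uacyclic_iff_bridges[OF noloop]
  proof (intro allI impI)
    fix u v assume "{u, v} \<in> uedges ?H"
    then obtain w where w: "w \<in> V" "p w \<noteq> w" "{u, v} = {w, p w}"
      by (auto simp: parent_edges_def)
    then have "u = w \<and> v = p w \<or> v = w \<and> u = p w" by (auto simp: doubleton_eq_iff)
    then show "(u, v) \<notin> (adj_rel (uedges ?H - {{u, v}}))\<^sup>*"
      using bridge[OF w(1,2)] adj_rel_rtrancl_sym unfolding w(3) by fastforce
  qed
  have "\<exists>!r. r \<in> C \<and> r \<in> {v \<in> V. p v = v}" if C_comp: "C \<in> ucomponents ?H" for C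
  proof -
    obtain u where u: "u \<in> V" and C: "C = {v. (u, v) \<in> (adj_rel (parent_edges p))\<^sup>*}"
      using C_comp[unfolded ucomponents_def, folded adj_rel_def] by (elim imageE) simp
    obtain n where n: "p ((p ^^ n) u) = (p ^^ n) u" using rt[OF u] by (auto simp: rooted_def)
    show ?thesis
    proof (rule ex1I[of _ "(p ^^ n) u"])
      show "(p ^^ n) u \<in> C \<and> (p ^^ n) u \<in> {v \<in> V. p v = v}"
        using n ancestor_connected[OF pc u] funpow_closed[OF pc u] by (auto simp: C)
      fix r assume r: "r \<in> C \<and> r \<in> {v \<in> V. p v = v}"
      then obtain m where "(p ^^ m) r = (p ^^ n) u"
        using reaches_root_connected[OF _ n refl] by (auto simp: C)
      then show "r = (p ^^ n) u" using r funpow_fixpoint[of p r m] by auto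
    qed
  qed
  then show ?thesis
    using parent_edges_subset[OF pc] ac
    by (auto simp: rooted_spanning_forests_def forest_of_def uspanning_subgraph_def)
qed

text \<open>
  The roots determine the parents level by level: once the parents agree on the vertices of
  depth \<open>n\<close>, a vertex \<open>v\<close> of depth \<open>n + 1\<close> with parent \<open>p v\<close> must have the same parent under
  \<open>q\<close>, because otherwise the edge \<open>{v, p v}\<close> would make \<open>v\<close> the parent of \<open>p v\<close>,
  and then \<open>p\<close> would exchange these two vertices.
\<close>

lemma inj_on_forest_of: "inj_on forest_of parent_functions"
proof (rule inj_onI)
  fix p q assume p: "p \<in> parent_functions" and q: "q \<in> parent_functions"
    and eq: "forest_of p = forest_of q"
  have roots: "p v = v \<longleftrightarrow> q v = v" if "v \<in> V" for v
    using eq that by (auto simp: forest_of_def)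
  have edges: "parent_edges p = parent_edges q"
    using eq by (auto simp: forest_of_def)
  have pc: "p \<in> parent_choices" "q \<in> parent_choices"
    using p q by (auto simp: parent_functions_def)
  have agree: "p v = q v" if "v \<in> V" "p ((p ^^ n) v) = (p ^^ n) v" for n v
    using that
  proof (induction n arbitrary: v)
    case 0
    then show ?case using roots[of v] by auto
  next
    case (Suc n)
    show ?case
    proof (cases "p v = v")
      case True
      then show ?thesis using roots[of v] Suc by auto
    next
      case False
      have IH: "p (p v) = q (p v)"
        using Suc.IH[of "p v"] Suc.prems choices_closed[OF pc(1)] by (auto simp: funpow_swap1)
      have "{v, p v} \<in> parent_edges q"
        using Suc.prems False edges by (auto simp: parent_edges_def)
      then have "p v = q v \<or> v = q (p v)" by (auto simp: parent_edges_def doubleton_eq_iff)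
      moreover have "v \<noteq> q (p v)"
      proof
        assume "v = q (p v)"
        then have "(p ^^ Suc 1) v = v" using IH by simp
        then show False using periodic_imp_fixpoint[of p v 1] False p Suc.prems
          by (auto simp: parent_functions_def)
      qed
      ultimately show ?thesis by blast
    qed
  qed
  show "p = q"
  proof (rule PiE_ext)
    show "p \<in> (\<Pi>\<^sub>E v\<in>V. insert v (nbrs v))" "q \<in> (\<Pi>\<^sub>E v\<in>V. insert v (nbrs v))"
      using pc by (auto simp: parent_choices_def)
    fix v assume "v \<in> V"
    then show "p v = q v" using p agree by (auto simp: parent_functions_def rooted_def)
  qed
qed


text \<open>
  The parent of a non-root is a neighbour in the forest that is closer to the set of roots.
  An edge \<open>{u, v}\<close> of the forest that joins no vertex to its parent cannot exist: the chains of
  ancestors of \<open>u\<close> and \<open>v\<close> end in the same root and avoid this edge, so they bypass it.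
\<close>

lemma forest_in_image_forest_of:
  assumes "(H, R) \<in> rooted_spanning_forests G"
  shows "(H, R) \<in> forest_of ` parent_functions"
proof -
  have vH: "uverts H = V" and eH: "uedges H \<subseteq> uedges G" and ac: "uacyclic H" and RV: "R \<subseteq> V"
    and root: "\<And>C. C \<in> ucomponents H \<Longrightarrow> \<exists>!r. r \<in> C \<and> r \<in> R"
    using assms by (auto simp: rooted_spanning_forests_def uspanning_subgraph_def)
  let ?A = "adj_rel (uedges H)"
  have comp: "{w. (v, w) \<in> ?A\<^sup>*} \<in> ucomponents H" if "v \<in> V" for v
    using that unfolding ucomponents_def adj_rel_def vH by (rule imageI)
  define d where "d v = (LEAST n. \<exists>r\<in>R. (v, r) \<in> ?A ^^ n)" for v
  have dR: "\<exists>r\<in>R. (v, r) \<in> ?A ^^ d v" if v: "v \<in> V" for v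
  proof -
    obtain r where "r \<in> R" "(v, r) \<in> ?A\<^sup>*" using root[OF comp[OF v]] by auto
    then have "\<exists>n. \<exists>r\<in>R. (v, r) \<in> ?A ^^ n" using rtrancl_imp_relpow by blast
    then show ?thesis unfolding d_def by (rule LeastI_ex)
  qed
  have closer: "\<exists>u. {v, u} \<in> uedges H \<and> d u < d v" if v: "v \<in> V" "v \<notin> R" for v
  proof -
    obtain r where r: "r \<in> R" "(v, r) \<in> ?A ^^ d v" using dR[OF v(1)] by auto
    then obtain m where m: "d v = Suc m" using v(2) by (cases "d v") auto
    then obtain u where u: "(v, u) \<in> ?A" "(u, r) \<in> ?A ^^ m" using r(2) relpow_Suc_D2[of v r m ?A] by auto
    have "d u \<le> m" unfolding d_def using u(2) r(1) by (intro Least_le) auto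
    then show ?thesis using u m by (auto simp: adj_rel_def)
  qed
  define p where "p = (\<lambda>v\<in>V. if v \<in> R then v else SOME u. {v, u} \<in> uedges H \<and> d u < d v)"
  have pR: "p v = v" if "v \<in> R" for v using that RV by (auto simp: p_def)
  have pN: "{v, p v} \<in> uedges H" "d (p v) < d v" if "v \<in> V" "v \<notin> R" for v
    using someI_ex[OF closer[OF that]] that by (auto simp: p_def)
  have fixR: "p v = v \<longleftrightarrow> v \<in> R" if "v \<in> V" for v
    using pR pN(2) that by (metis less_irrefl)
  have pc: "p \<in> parent_choices"
    unfolding parent_choices_def
  proof (rule PiE_I)
    fix v assume "v \<in> V"
    then show "p v \<in> insert v (nbrs v)"
      using pR[of v] pN[of v] eH by (cases "v \<in> R") (auto simp: nbrs_def)
  qed (simp add: p_def)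
  have "\<exists>n. p ((p ^^ n) v) = (p ^^ n) v" if "v \<in> V" for v
    using that
  proof (induction "d v" arbitrary: v rule: less_induct)
    case less
    show ?case
    proof (cases "v \<in> R")
      case True
      then show ?thesis using pR by (intro exI[of _ 0]) auto
    next
      case False
      then obtain n where "p ((p ^^ n) (p v)) = (p ^^ n) (p v)"
        using less.hyps[of "p v"] less.prems pN choices_closed[OF pc] by blast
      then show ?thesis by (intro exI[of _ "Suc n"]) (simp add: funpow_swap1)
    qed
  qed
  then have rt: "rooted p v" if "v \<in> V" for v using that by (auto simp: rooted_def)
  have pe: "parent_edges p \<subseteq> uedges H"
    using pN(1) pR by (auto simp: parent_edges_def)
  have "uedges H \<subseteq> parent_edges p"
  proof
    fix e assume e: "e \<in> uedges H"
    then obtain u v where uv: "e = {u, v}" using eH edge_doubleton by blast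
    have uvV: "u \<in> V" "v \<in> V" using e eH edge_ends uv by auto
    show "e \<in> parent_edges p"
    proof (rule ccontr)
      assume "e \<notin> parent_edges p"
      then have sub: "parent_edges p \<subseteq> uedges H - {{u, v}}" using pe uv by auto
      let ?B = "adj_rel (uedges H - {{u, v}})"
      have to_root: "\<exists>r\<in>R. (w, r) \<in> ?B\<^sup>*" if w: "w \<in> V" for w
      proof -
        obtain n where n: "p ((p ^^ n) w) = (p ^^ n) w" using rt[OF w] by (auto simp: rooted_def)
        have "(w, (p ^^ n) w) \<in> ?B\<^sup>*"
          using ancestor_connected[OF pc w] rtrancl_mono[OF adj_rel_mono[OF sub]] by blast
        then show ?thesis using n fixR[of "(p ^^ n) w"] funpow_closed[OF pc w] by blast
      qed
      obtain r r' where r: "r \<in> R" "(u, r) \<in> ?B\<^sup>*" and r': "r' \<in> R" "(v, r') \<in> ?B\<^sup>*"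
        using to_root uvV by meson
      have BA: "?B\<^sup>* \<subseteq> ?A\<^sup>*" by (intro rtrancl_mono adj_rel_mono) auto
      have "(u, v) \<in> ?A" using e uv by (auto simp: adj_rel_def)
      then have "(u, r') \<in> ?A\<^sup>*" using r' BA by (meson converse_rtrancl_into_rtrancl subsetD)
      then have "r = r'" using root[OF comp[OF uvV(1)]] r r' BA by blast
      then have "(u, v) \<in> ?B\<^sup>*" using r r' adj_rel_rtrancl_sym by (metis rtrancl_trans)
      moreover have "{w} \<notin> uedges H" for w using edge_ends[of w w] eH by auto
      ultimately show False using uacyclic_iff_bridges[of H] ac e uv by blast
    qed
  qed
  then have "forest_of p = (H, R)"
    using pe vH RV fixR by (auto simp: forest_of_def intro!: ugraph.equality)
  then show ?thesis using pc rt by (force simp: parent_functions_def)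
qed

lemma card_rooted_spanning_forests:
  "card (rooted_spanning_forests G) = card parent_functions"
proof -
  have "rooted_spanning_forests G = forest_of ` parent_functions"
    using forest_of_in_forests forest_in_image_forest_of by auto
  then show ?thesis using card_image[OF inj_on_forest_of] by simp
qed

end

section \<open>The matrix theorem for rooted spanning forests\<close>

text \<open>
  Multilinearity of the determinant in all rows at once.
\<close>

lemma det_sum_rows:
  fixes B :: "nat \<Rightarrow> 'b \<Rightarrow> nat \<Rightarrow> 'a :: comm_ring_1"
  assumes "\<And>i. i < n \<Longrightarrow> finite (C i)"
  shows "Determinant.det (mat n n (\<lambda>(i, j). \<Sum>c\<in>C i. B i c j)) =
         (\<Sum>p\<in>(\<Pi>\<^sub>E i\<in>{..<n}. C i). Determinant.det (mat n n (\<lambda>(i, j). B i (p i) j)))"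
proof -
  have "Determinant.det (mat n n (\<lambda>(i, j). \<Sum>c\<in>C i. B i c j)) =
     (\<Sum>\<sigma> | \<sigma> permutes {0..<n}. signof \<sigma> * (\<Prod>i\<in>{..<n}. \<Sum>c\<in>C i. B i c (\<sigma> i)))"
    by (subst det_def'[of _ n])
       (auto intro!: sum.cong arg_cong2[where f = "(*)"] prod.cong simp: atLeast0LessThan permutes_in_image)
  also have "\<dots> = (\<Sum>\<sigma> | \<sigma> permutes {0..<n}.
      \<Sum>p\<in>(\<Pi>\<^sub>E i\<in>{..<n}. C i). signof \<sigma> * (\<Prod>i\<in>{..<n}. B i (p i) (\<sigma> i)))"
    using assms by (subst prod_sum_PiE) (auto simp: sum_distrib_left)
  also have "\<dots> = (\<Sum>p\<in>(\<Pi>\<^sub>E i\<in>{..<n}. C i).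
      \<Sum>\<sigma> | \<sigma> permutes {0..<n}. signof \<sigma> * (\<Prod>i\<in>{..<n}. B i (p i) (\<sigma> i)))"
    by (rule sum.swap)
  also have "\<dots> = (\<Sum>p\<in>(\<Pi>\<^sub>E i\<in>{..<n}. C i). Determinant.det (mat n n (\<lambda>(i, j). B i (p i) j)))"
    by (subst det_def'[of _ n])
       (auto intro!: sum.cong arg_cong2[where f = "(*)"] prod.cong simp: atLeast0LessThan permutes_in_image)
  finally show ?thesis .
qed

text \<open>
  If all vertices are rooted, then only the identity contributes to the Leibniz formula:
  a permutation with nonzero product sends each point that it moves to its parent, and
  moves that parent as well, so a moved point would have no root among its ancestors.
  Otherwise the indicator of the vertices without a root is in the kernel, as a vertex
  that is no root is rooted if and only if its parent is.
\<close>

lemma det_parent_matrix: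
  assumes p: "\<And>v. v < n \<Longrightarrow> p v < n"
  shows "Determinant.det (mat n n (\<lambda>(v, w). of_bool (v = w) - of_bool (p v \<noteq> v \<and> w = p v))) =
     (of_bool (\<forall>v<n. rooted p v) :: 'a :: idom)"
proof -
  let ?A = "mat n n (\<lambda>(v, w). of_bool (v = w) - of_bool (p v \<noteq> v \<and> w = p v)) :: 'a mat"
  have A: "?A \<in> carrier_mat n n" by simp
  show ?thesis
  proof (cases "\<forall>v<n. rooted p v")
    case True
    have entry: "?A $$ (v, w) = of_bool (v = w) - of_bool (p v \<noteq> v \<and> w = p v)" if "v < n" "w < n" for v w
      using that by simp
    have zero: "(\<Prod>v = 0..<n. ?A $$ (v, \<sigma> v)) = 0" if \<sigma>: "\<sigma> permutes {0..<n}" "\<sigma> \<noteq> id" for \<sigma>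
    proof (rule ccontr)
      assume "(\<Prod>v = 0..<n. ?A $$ (v, \<sigma> v)) \<noteq> 0"
      then have nz: "?A $$ (v, \<sigma> v) \<noteq> 0" if "v < n" for v
        using that by (auto simp: prod_zero_iff)
      have \<sigma>_bound: "\<sigma> v < n" if "v < n" for v
        using permutes_in_image[OF \<sigma>(1), of v] that by auto
      have step: "\<sigma> v = p v" if "v < n" "\<sigma> v \<noteq> v" for v
        using nz[OF that(1)] that entry[OF that(1) \<sigma>_bound[OF that(1)]] by (auto split: if_splits)
      obtain v where v: "\<sigma> v \<noteq> v" using \<sigma>(2) by (auto simp: fun_eq_iff)
      then have "v < n" using \<sigma>(1) by (auto simp: permutes_def)
      have moved: "(p ^^ i) v < n \<and> \<sigma> ((p ^^ i) v) \<noteq> (p ^^ i) v" for i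
      proof (induction i)
        case (Suc i)
        then have "\<sigma> ((p ^^ i) v) = p ((p ^^ i) v)" using step by blast
        moreover have "\<sigma> (\<sigma> ((p ^^ i) v)) \<noteq> \<sigma> ((p ^^ i) v)"
          using Suc permutes_inj[OF \<sigma>(1)] by (auto simp: inj_eq)
        ultimately show ?case using Suc p by auto
      qed (use v \<open>v < n\<close> in auto)
      obtain i where "p ((p ^^ i) v) = (p ^^ i) v" using True \<open>v < n\<close> by (auto simp: rooted_def)
      then show False using moved[of i] step by metis
    qed
    have "Determinant.det ?A = (\<Sum>\<sigma> | \<sigma> permutes {0..<n}. signof \<sigma> * (\<Prod>v = 0..<n. ?A $$ (v, \<sigma> v)))"
      by (rule det_def'[OF A])
    also have "\<dots> = (\<Sum>\<sigma>\<in>{id}. signof \<sigma> * (\<Prod>v = 0..<n. ?A $$ (v, \<sigma> v)))"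
      by (intro sum.mono_neutral_right) (auto simp: finite_permutations permutes_id zero simp del: index_mat)
    also have "\<dots> = 1" by (auto intro!: prod.neutral)
    finally show ?thesis using True by simp
  next
    case False
    then obtain v0 where v0: "v0 < n" "\<not> rooted p v0" by auto
    define x where "x = vec n (\<lambda>v. of_bool (\<not> rooted p v) :: 'a)"
    have fix_rooted: "rooted p v" if "p v = v" for v
      using that unfolding rooted_def by (intro exI[of _ 0]) simp
    have "vec_index x v0 = 1" using v0 by (simp add: x_def)
    then have "x \<noteq> 0\<^sub>v n" using v0 by auto
    moreover have "?A *\<^sub>v x = 0\<^sub>v n"
    proof (rule eq_vecI)
      fix v assume "v < dim_vec (0\<^sub>v n :: 'a vec)"
      then have v: "v < n" by simp
      have "vec_index (?A *\<^sub>v x) v = (\<Sum>w\<in>{0..<n}. (of_bool (v = w) - of_bool (p v \<noteq> v \<and> w = p v)) * vec_index x (w))"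
        using v by (simp add: scalar_prod_def x_def)
      also have "\<dots> = (\<Sum>w\<in>{0..<n}. if w = v then vec_index x (w) else 0) - (\<Sum>w\<in>{0..<n}. if w = p v then of_bool (p v \<noteq> v) * vec_index x (w) else 0)"
        unfolding sum_subtractf[symmetric] by (intro sum.cong) auto
      also have "\<dots> = vec_index x (v) - of_bool (p v \<noteq> v) * vec_index x (p v)"
        using v p[OF v] by (simp add: sum.delta)
      also have "\<dots> = 0"
        using v p[OF v] rooted_parent_iff[of p v] fix_rooted[of v] by (auto simp: x_def)
      finally show "vec_index (?A *\<^sub>v x) v = vec_index (0\<^sub>v n) v" using v by simp
    qed simp
    moreover have "x \<in> carrier_vec n" by (simp add: x_def)
    ultimately have "Determinant.det ?A = 0"
      using det_0_iff_vec_prod_zero[OF A] by blast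
    then show ?thesis using False by simp
  qed
qed

text \<open>
  The expansion is over all choices of an element of \<open>insert v (nbrs v)\<close> for every vertex \<open>v\<close>: the row
  of \<open>v\<close> contains \<open>e\<^sub>v\<close> once for each choice, which yields the diagonal entry \<open>1 + deg v\<close>, and
  \<open>- e\<^sub>c\<close> for each choice \<open>c \<noteq> v\<close>.
\<close>

theorem det_forest_matrix:
  fixes G :: "nat ugraph"
  assumes G: "finite_ugraph G" and V: "uverts G = {..<n}"
  shows "Determinant.det (mat n n (\<lambda>(v, w).
           of_nat (Suc (card (finite_ugraph.nbrs G v))) * of_bool (v = w) - of_bool (w \<in> finite_ugraph.nbrs G v))) =
         (of_nat (card (rooted_spanning_forests G)) :: 'a :: idom)"
proof -
  interpret finite_ugraph G by (rule G)
  have entry: "of_nat (Suc (card (nbrs v))) * of_bool (v = w) - of_bool (w \<in> nbrs v) =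
      (\<Sum>c\<in>insert v (nbrs v). of_bool (v = w) - of_bool (c \<noteq> v \<and> w = c) :: 'a)" for v w
  proof -
    have "(\<Sum>c\<in>nbrs v. of_bool (c \<noteq> v \<and> w = c) :: 'a) = (\<Sum>c\<in>nbrs v. if w = c then 1 else 0)"
      using not_in_nbrs[of v] by (intro sum.cong) auto
    also have "\<dots> = of_bool (w \<in> nbrs v)" using finite_nbrs[of v] by (simp add: sum.delta')
    finally have "(\<Sum>c\<in>nbrs v. of_bool (c \<noteq> v \<and> w = c) :: 'a) = of_bool (w \<in> nbrs v)" .
    then show ?thesis
      using finite_nbrs[of v] not_in_nbrs[of v] by (simp add: sum_subtractf algebra_simps)
  qed
  have choices: "parent_choices = (\<Pi>\<^sub>E v\<in>{..<n}. insert v (nbrs v))"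
    by (simp add: parent_choices_def V)
  have "Determinant.det (mat n n (\<lambda>(v, w).
           of_nat (Suc (card (nbrs v))) * of_bool (v = w) - of_bool (w \<in> nbrs v))) =
        (\<Sum>p\<in>parent_choices. Determinant.det (mat n n (\<lambda>(v, w).
           of_bool (v = w) - of_bool (p v \<noteq> v \<and> w = p v))) :: 'a)"
    unfolding entry choices using finite_nbrs by (intro det_sum_rows) auto
  also have "\<dots> = (\<Sum>p\<in>parent_choices. of_bool (\<forall>v<n. rooted p v))"
    using choices_closed V by (intro sum.cong refl det_parent_matrix) auto
  also have "\<dots> = of_nat (card (parent_choices \<inter> {p. \<forall>v<n. rooted p v}))"
    using finite_parent_choices by simp
  also have "parent_choices \<inter> {p. \<forall>v<n. rooted p v} = parent_functions"
    using V by (auto simp: parent_functions_def)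
  finally show ?thesis using card_rooted_spanning_forests by simp
qed

section \<open>Rooted spanning forests in circulant graphs\<close>

text \<open>
  With \<open>\<alpha> = 0\<close> this is the orthogonality of the characters of the integers modulo \<open>m\<close>.  The
  shift is for the odd \<open>2n\<close>-th roots of unity, where \<open>\<alpha> = 1/2\<close>.
\<close>

lemma sum_cis_equispaced:
  assumes "m > 0"
  shows "(\<Sum>j<m. cis (2 * pi * of_int a * ((real j + \<alpha>) / real m))) =
         (if int m dvd a then of_nat m * cis (2 * pi * of_int a * (\<alpha> / real m)) else 0)"
proof -
  define z where "z = cis (2 * pi * of_int a / real m)"
  have "cis (2 * pi * of_int a * ((real j + \<alpha>) / real m)) = cis (2 * pi * of_int a * (\<alpha> / real m)) * z ^ j" for j
    by (simp add: z_def cis_mult Complex.DeMoivre add_divide_distrib algebra_simps)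
  then have eq: "(\<Sum>j<m. cis (2 * pi * of_int a * ((real j + \<alpha>) / real m))) =
      cis (2 * pi * of_int a * (\<alpha> / real m)) * (\<Sum>j<m. z ^ j)"
    by (simp add: sum_distrib_left)
  have z1: "z = 1 \<longleftrightarrow> int m dvd a"
  proof
    assume "z = 1"
    then obtain q :: int where "2 * pi * of_int a / real m = of_int q * (2 * pi)"
      by (auto simp: z_def cis_eq_1_iff)
    then have "of_int a = (of_int (q * int m) :: real)" using assms by (simp add: field_simps)
    then have "a = q * int m" by (simp only: of_int_eq_iff)
    then show "int m dvd a" by simp
  next
    assume "int m dvd a"
    then obtain q where "a = int m * q" by auto
    then have "2 * pi * of_int a / real m = of_int q * (2 * pi)" using assms by (simp add: field_simps)
    then show "z = 1" by (auto simp: z_def cis_eq_1_iff)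
  qed
  have "z ^ m = cis (2 * pi * of_int a)"
    using assms by (simp add: z_def Complex.DeMoivre)
  also have "\<dots> = 1" by (intro cis_multiple_2pi) auto
  finally have "z \<noteq> 1 \<Longrightarrow> (\<Sum>j<m. z ^ j) = 0" by (simp add: sum_gp_strict)
  with eq z1 show ?thesis by (cases "int m dvd a") (auto simp: mult.commute)
qed

text \<open>
  The columns of the Fourier matrix are eigenvectors, and it is invertible because its
  product with its complex conjugate is \<open>m\<close> times the identity.
\<close>

lemma det_circulant_matrix:
  fixes c :: "int \<Rightarrow> complex"
  assumes m: "m > 0" and D: "finite D"
  shows "Determinant.det (mat m m (\<lambda>(i, j). \<Sum>d\<in>D. c d * of_bool ((int i + d) mod int m = int j))) =
         (\<Prod>l<m. \<Sum>d\<in>D. c d * cis (2 * pi * of_int d * (real l / real m)))"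
proof -
  define ev where "ev l = (\<Sum>d\<in>D. c d * cis (2 * pi * of_int d * (real l / real m)))" for l
  let ?A = "mat m m (\<lambda>(i, j). \<Sum>d\<in>D. c d * of_bool ((int i + d) mod int m = int j))"
  let ?F = "mat m m (\<lambda>(i, l). cis (2 * pi * real i * (real l / real m)))"
  let ?F' = "mat m m (\<lambda>(i, l). cis (- (2 * pi * real i * (real l / real m))))"
  let ?D = "mat m m (\<lambda>(i, l). if i = l then ev l else 0)"
  have shift: "(\<Sum>j<m. of_bool ((int i + d) mod int m = int j) * cis (2 * pi * real j * (real l / real m)))
      = cis (2 * pi * real i * (real l / real m)) * cis (2 * pi * of_int d * (real l / real m))" for i d l
  proof -
    define j where "j = nat ((int i + d) mod int m)"
    have j: "int j = (int i + d) mod int m" "j < m" using m by (auto simp: j_def nat_less_iff)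
    obtain q where q: "int i + d = int j + int m * q"
      unfolding j(1) by (metis mod_mult_div_eq)
    then have "real i + of_int d = real j + real m * of_int q"
      by (metis of_int_add of_int_mult of_int_of_nat_eq)
    moreover have "2 * pi * real i * (real l / real m) + 2 * pi * of_int d * (real l / real m)
        = 2 * pi * (real i + of_int d) * (real l / real m)" by (simp add: algebra_simps)
    ultimately have "2 * pi * real i * (real l / real m) + 2 * pi * of_int d * (real l / real m)
        = 2 * pi * real j * (real l / real m) + 2 * pi * (of_int (q * int l))"
      using m by (simp add: field_simps)
    then have "cis (2 * pi * real i * (real l / real m)) * cis (2 * pi * of_int d * (real l / real m))
        = cis (2 * pi * real j * (real l / real m)) * cis (2 * pi * of_int (q * int l))"
      unfolding cis_mult by (rule arg_cong)
    also have "cis (2 * pi * of_int (q * int l)) = 1" by (intro cis_multiple_2pi) auto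
    finally have 1: "cis (2 * pi * real i * (real l / real m)) * cis (2 * pi * of_int d * (real l / real m))
        = cis (2 * pi * real j * (real l / real m))" by simp
    have "(\<Sum>j'<m. of_bool ((int i + d) mod int m = int j') * cis (2 * pi * real j' * (real l / real m))) =
        (\<Sum>j'<m. if j' = j then cis (2 * pi * real j' * (real l / real m)) else 0)"
      unfolding j(1)[symmetric] by (intro sum.cong) auto
    also have "\<dots> = cis (2 * pi * real j * (real l / real m))" using j(2) by simp
    finally show ?thesis using 1 by simp
  qed
  have AF: "?A * ?F = ?F * ?D"
  proof (rule eq_matI)
    fix i l assume "i < dim_row (?F * ?D)" "l < dim_col (?F * ?D)"
    then have il: "i < m" "l < m" by auto
    have "(?A * ?F) $$ (i, l) = (\<Sum>j<m. (\<Sum>d\<in>D. c d * of_bool ((int i + d) mod int m = int j)) * cis (2 * pi * real j * (real l / real m)))"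
      using il by (simp add: scalar_prod_def atLeast0LessThan)
    also have "\<dots> = (\<Sum>d\<in>D. c d * (\<Sum>j<m. of_bool ((int i + d) mod int m = int j) * cis (2 * pi * real j * (real l / real m))))"
      unfolding sum_distrib_left sum_distrib_right by (subst sum.swap) (simp add: mult.assoc)
    also have "\<dots> = cis (2 * pi * real i * (real l / real m)) * ev l"
      unfolding shift ev_def sum_distrib_left by (simp add: mult_ac)
    also have "\<dots> = (\<Sum>j<m. if j = l then cis (2 * pi * real i * (real j / real m)) * ev l else 0)"
      using il by simp
    also have "\<dots> = (?F * ?D) $$ (i, l)"
      using il by (simp add: scalar_prod_def atLeast0LessThan if_distrib cong: if_cong)
    finally show "(?A * ?F) $$ (i, l) = (?F * ?D) $$ (i, l)" .
  qed auto
  have FF': "?F * ?F' = of_nat m \<cdot>\<^sub>m 1\<^sub>m m"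
  proof (rule eq_matI)
    fix i l assume "i < dim_row (of_nat m \<cdot>\<^sub>m 1\<^sub>m m :: complex mat)" "l < dim_col (of_nat m \<cdot>\<^sub>m 1\<^sub>m m :: complex mat)"
    then have il: "i < m" "l < m" by auto
    have "(?F * ?F') $$ (i, l) = (\<Sum>j<m. cis (2 * pi * of_int (int i - int l) * ((real j + 0) / real m)))"
      using il by (simp add: scalar_prod_def atLeast0LessThan cis_mult algebra_simps)
    also have "\<dots> = (if int m dvd int i - int l then of_nat m else 0)"
      by (subst sum_cis_equispaced[OF m]) auto
    also have "int m dvd int i - int l \<longleftrightarrow> i = l"
      using il by (simp add: mod_eq_dvd_iff[symmetric])
    finally show "(?F * ?F') $$ (i, l) = (of_nat m \<cdot>\<^sub>m 1\<^sub>m m) $$ (i, l)"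
      using il by auto
  qed auto
  have car: "?A \<in> carrier_mat m m" "?F \<in> carrier_mat m m" "?F' \<in> carrier_mat m m" "?D \<in> carrier_mat m m"
    by auto
  have "Determinant.det ?F * Determinant.det ?F' = of_nat m ^ m"
    using det_mult[OF car(2,3)] FF' by simp
  then have "Determinant.det ?F \<noteq> 0" using m by auto
  moreover have "Determinant.det ?A * Determinant.det ?F = Determinant.det ?F * Determinant.det ?D"
    unfolding det_mult[OF car(1,2), symmetric] det_mult[OF car(2,4), symmetric] AF ..
  ultimately have "Determinant.det ?A = Determinant.det ?D" by (simp add: mult.commute)
  also have "\<dots> = prod_list (diag_mat ?D)"
    by (rule det_upper_triangular[OF _ car(4)]) auto
  also have "\<dots> = (\<Prod>l<m. ev l)"
    by (auto simp: prod_list_diag_prod atLeast0LessThan intro!: prod.cong)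
  finally show ?thesis by (simp add: ev_def)
qed


text \<open>
  The differences, modulo \<open>m\<close>, from a vertex to its neighbours in \<open>circulant m T\<close>.  The jump
  \<open>m / 2\<close> is taken with one sign only, as its two signs lead to the same vertex.
\<close>

definition circulant_offsets :: "nat \<Rightarrow> nat set \<Rightarrow> int set" where
  "circulant_offsets m T = int ` T \<union> (\<lambda>t. - int t) ` {t \<in> T. 2 * t \<noteq> m}"

context
  fixes m :: nat and T :: "nat set"
  assumes m: "m > 0" and finT: "finite T" and jumps: "\<And>t. t \<in> T \<Longrightarrow> 1 \<le> t \<and> 2 * t \<le> m"
begin

lemma offset_bounds: "d \<in> circulant_offsets m T \<Longrightarrow> d \<noteq> 0 \<and> - int m < 2 * d \<and> 2 * d \<le> int m"
  using jumps by (fastforce simp: circulant_offsets_def)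

lemma finite_offsets: "finite (circulant_offsets m T)"
  using finT by (auto simp: circulant_offsets_def)

text \<open>
  All offsets are in a half-open interval of length \<open>m\<close>, so that distinct offsets lead to
  distinct neighbours.
\<close>

lemma offsets_cong_iff:
  assumes "d \<in> circulant_offsets m T" "d' \<in> circulant_offsets m T"
  shows "(x + d) mod int m = (x + d') mod int m \<longleftrightarrow> d = d'"
proof
  assume "(x + d) mod int m = (x + d') mod int m"
  then have "int m dvd d - d'" by (simp add: mod_eq_dvd_iff)
  moreover have "\<bar>d - d'\<bar> < int m" using offset_bounds[OF assms(1)] offset_bounds[OF assms(2)] by linarith
  ultimately show "d = d'" using dvd_imp_le_int[of "d - d'" "int m"] by force
qed simp

lemma step_iff_offset:
  "(\<exists>t\<in>T. y = (x + int t) mod int m \<or> y = (x - int t) mod int m) \<longleftrightarrow>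
   (\<exists>d\<in>circulant_offsets m T. (x + d) mod int m = y)"
proof -
  have half: "(x - int t) mod int m = (x + int t) mod int m" if "2 * t = m" for t
    using that by (auto simp: mod_eq_dvd_iff)
  show ?thesis
  proof
    assume "\<exists>t\<in>T. y = (x + int t) mod int m \<or> y = (x - int t) mod int m"
    then obtain t where t: "t \<in> T" "y = (x + int t) mod int m \<or> y = (x - int t) mod int m" by auto
    show "\<exists>d\<in>circulant_offsets m T. (x + d) mod int m = y"
    proof (cases "y = (x + int t) mod int m")
      case True
      then show ?thesis using t by (intro bexI[of _ "int t"]) (auto simp: circulant_offsets_def)
    next
      case False
      then have "2 * t \<noteq> m" "y = (x - int t) mod int m" using half[of t] t by auto
      then show ?thesis using t by (intro bexI[of _ "- int t"]) (auto simp: circulant_offsets_def)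
    qed
  next
    assume "\<exists>d\<in>circulant_offsets m T. (x + d) mod int m = y"
    then obtain d where "d \<in> circulant_offsets m T" "(x + d) mod int m = y" by auto
    then show "\<exists>t\<in>T. y = (x + int t) mod int m \<or> y = (x - int t) mod int m"
      by (auto simp: circulant_offsets_def)
  qed
qed

lemma step_sym:
  assumes "i < m" "j < m"
  shows "(\<exists>t\<in>T. int j = (int i + int t) mod int m \<or> int j = (int i - int t) mod int m) \<longleftrightarrow>
         (\<exists>t\<in>T. int i = (int j + int t) mod int m \<or> int i = (int j - int t) mod int m)"
proof -
  have dvd: "int a = (int b + c) mod int m \<longleftrightarrow> int m dvd int a - (int b + c)" if "a < m" for a b :: nat and c
    using that mod_eq_dvd_iff[of "int a" "int m" "int b + c"] by simp
  have *: "int a = (int b + c) mod int m \<longleftrightarrow> int b = (int a + - c) mod int m"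
    if "a < m" "b < m" for a b :: nat and c
  proof -
    have "int b - (int a + - c) = - (int a - (int b + c))" by simp
    then show ?thesis unfolding dvd[OF that(1)] dvd[OF that(2)] by (simp only: dvd_minus_iff)
  qed
  have "int j = (int i + int t) mod int m \<longleftrightarrow> int i = (int j - int t) mod int m" for t
    using *[OF assms(2,1), of "int t"] by simp
  moreover have "int j = (int i - int t) mod int m \<longleftrightarrow> int i = (int j + int t) mod int m" for t
    using *[OF assms(2,1), of "- int t"] by simp
  ultimately show ?thesis by metis
qed

lemma circulant_edge_iff:
  "{i, j} \<in> uedges (circulant m T) \<longleftrightarrow>
     i < m \<and> j < m \<and> (\<exists>d\<in>circulant_offsets m T. (int i + d) mod int m = int j)"
proof -
  let ?P = "\<lambda>i j. \<exists>t\<in>T. int j = (int i + int t) mod int m \<or> int j = (int i - int t) mod int m"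
  have "{i, j} \<in> uedges (circulant m T) \<longleftrightarrow> i < m \<and> j < m \<and> (?P i j \<or> ?P j i)"
    unfolding circulant_def ugraph.simps mem_Collect_eq doubleton_eq_iff by blast
  then show ?thesis using step_sym[of i j] unfolding step_iff_offset by blast
qed

lemma finite_ugraph_circulant: "finite_ugraph (circulant m T)"
proof
  show "finite (uverts (circulant m T))" by (simp add: circulant_def)
  fix e assume "e \<in> uedges (circulant m T)"
  then show "\<exists>u v. e = {u, v}" by (auto simp: circulant_def)
next
  fix u v assume e: "{u, v} \<in> uedges (circulant m T)"
  then obtain d where d: "u < m" "v < m" "d \<in> circulant_offsets m T" "(int u + d) mod int m = int v"
    unfolding circulant_edge_iff by auto
  have "u \<noteq> v"
  proof
    assume "u = v"
    then have "(int u + d) mod int m = (int u + 0) mod int m" using d by simp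
    then have "int m dvd d" unfolding mod_eq_dvd_iff by simp
    then show False using offset_bounds[OF d(3)] dvd_imp_le_int[of d "int m"] by force
  qed
  then show "u \<in> uverts (circulant m T) \<and> v \<in> uverts (circulant m T) \<and> u \<noteq> v"
    using d by (simp add: circulant_def)
qed

text \<open>
  The value of \<open>c\<close> at the offset \<open>0\<close> is the diagonal entry of \<open>I + L\<close>, and at the other offsets
  it is the entry \<open>-1\<close> for an edge.
\<close>

lemma card_rooted_spanning_forests_circulant:
  "complex_of_nat (card (rooted_spanning_forests (circulant m T))) =
    (\<Prod>l<m. 1 + of_nat (card (circulant_offsets m T)) -
       (\<Sum>d\<in>circulant_offsets m T. cis (2 * pi * of_int d * (real l / real m))))"
proof -
  let ?D = "circulant_offsets m T"
  interpret finite_ugraph "circulant m T" by (rule finite_ugraph_circulant)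
  define c where "c d = (if d = 0 then 1 + of_nat (card ?D) else - 1 :: complex)" for d :: int
  have D0: "0 \<notin> ?D" using offset_bounds by blast
  have csum: "(\<Sum>d\<in>insert 0 ?D. c d * f d) = (1 + of_nat (card ?D)) * f 0 - (\<Sum>d\<in>?D. f d)" for f
  proof -
    have "(\<Sum>d\<in>?D. c d * f d) = (\<Sum>d\<in>?D. - f d)"
      using D0 by (intro sum.cong) (auto simp: c_def)
    then show ?thesis using D0 finite_offsets by (simp add: c_def sum_negf)
  qed
  have nbr_iff: "w \<in> nbrs v \<longleftrightarrow> (\<exists>d\<in>?D. (int v + d) mod int m = int w)" if "v < m" "w < m" for v w
    using that by (simp add: nbrs_def circulant_edge_iff)
  have card_nbrs: "card (nbrs v) = card ?D" if v: "v < m" for v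
  proof -
    have "nbrs v = (\<lambda>d. nat ((int v + d) mod int m)) ` ?D"
      using v m by (auto simp: nbrs_def circulant_edge_iff image_iff nat_less_iff) (metis nat_int)
    moreover have "inj_on (\<lambda>d. nat ((int v + d) mod int m)) ?D"
      using offsets_cong_iff m by (intro inj_onI) (simp add: eq_nat_nat_iff)
    ultimately show ?thesis by (simp add: card_image)
  qed
  have one: "(\<Sum>d\<in>?D. of_bool ((int v + d) mod int m = int w)) = (of_bool (w \<in> nbrs v) :: complex)"
    if vw: "v < m" "w < m" for v w
  proof (cases "w \<in> nbrs v")
    case True
    then obtain d where d: "d \<in> ?D" "(int v + d) mod int m = int w" using nbr_iff[OF vw] by auto
    then have "(int v + d') mod int m = int w \<longleftrightarrow> d' = d" if "d' \<in> ?D" for d'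
      using offsets_cong_iff[OF that d(1), of "int v"] by simp
    then have "(\<Sum>d'\<in>?D. of_bool ((int v + d') mod int m = int w)) = (\<Sum>d'\<in>?D. if d' = d then 1 else 0 :: complex)"
      by (intro sum.cong) auto
    then show ?thesis using True d finite_offsets by simp
  next
    case False
    then show ?thesis using nbr_iff[OF vw] by (auto intro!: sum.neutral)
  qed
  have "complex_of_nat (card (rooted_spanning_forests (circulant m T))) =
      Determinant.det (mat m m (\<lambda>(v, w). of_nat (Suc (card (nbrs v))) * of_bool (v = w) - of_bool (w \<in> nbrs v)))"
    by (rule det_forest_matrix[symmetric, OF finite_ugraph_circulant]) (simp add: circulant_def)
  also have "mat m m (\<lambda>(v, w). of_nat (Suc (card (nbrs v))) * of_bool (v = w) - of_bool (w \<in> nbrs v)) =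
      mat m m (\<lambda>(v, w). \<Sum>d\<in>insert 0 ?D. c d * of_bool ((int v + d) mod int m = int w))"
    unfolding csum by (rule eq_matI) (simp_all add: one card_nbrs)
  also have "Determinant.det \<dots> = (\<Prod>l<m. \<Sum>d\<in>insert 0 ?D. c d * cis (2 * pi * of_int d * (real l / real m)))"
    using m finite_offsets by (intro det_circulant_matrix) auto
  also have "\<dots> = (\<Prod>l<m. 1 + of_nat (card ?D) - (\<Sum>d\<in>?D. cis (2 * pi * of_int d * (real l / real m))))"
    unfolding csum by simp
  finally show ?thesis .
qed

end

section \<open>Riemann sums of logarithms of trigonometric polynomials\<close>

text \<open>
  Trigonometric polynomials of degree at most \<open>d\<close>.  Generating them by sums of monomials
  reduces products and quadrature to monomials without handling coefficients.
\<close>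

inductive trig_poly :: "nat \<Rightarrow> (real \<Rightarrow> complex) \<Rightarrow> bool" for d where
  monomial: "\<bar>a\<bar> \<le> int d \<Longrightarrow> trig_poly d (\<lambda>t. c * cis (2 * pi * of_int a * t))"
| add: "trig_poly d f \<Longrightarrow> trig_poly d g \<Longrightarrow> trig_poly d (\<lambda>t. f t + g t)"

lemma trig_poly_mono: "trig_poly d f \<Longrightarrow> d \<le> e \<Longrightarrow> trig_poly e f"
  by (induction rule: trig_poly.induct) (auto intro: trig_poly.intros)

lemma trig_poly_const: "trig_poly d (\<lambda>t. c)"
  using trig_poly.monomial[of 0 d c] by simp

lemma trig_poly_monomial_mult:
  assumes "trig_poly e g" and a: "\<bar>a\<bar> \<le> int d"
  shows "trig_poly (d + e) (\<lambda>t. c * cis (2 * pi * of_int a * t) * g t)"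
  using assms(1)
proof (induction rule: trig_poly.induct)
  case (monomial b c')
  have cis_add: "cis (2 * pi * of_int (a + b) * t) = cis (2 * pi * of_int a * t) * cis (2 * pi * of_int b * t)" for t
    unfolding cis_mult by (simp add: algebra_simps)
  have eq: "c * cis (2 * pi * of_int a * t) * (c' * cis (2 * pi * of_int b * t)) =
      (c * c') * cis (2 * pi * of_int (a + b) * t)" for t
    unfolding cis_add by (simp only: mult_ac)
  show ?case unfolding eq using a monomial by (intro trig_poly.monomial) auto
next
  case (add f g)
  then show ?case using trig_poly.add[OF add.IH] by (simp add: algebra_simps)
qed

lemma trig_poly_mult:
  assumes "trig_poly d f" "trig_poly e g"
  shows "trig_poly (d + e) (\<lambda>t. f t * g t)"
  using assms(1)
proof (induction rule: trig_poly.induct)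
  case (monomial a c)
  then show ?case by (rule trig_poly_monomial_mult[OF assms(2)])
next
  case (add f1 f2)
  then show ?case using trig_poly.add[OF add.IH] by (simp add: algebra_simps)
qed

lemma trig_poly_power: "trig_poly d f \<Longrightarrow> trig_poly (r * d) (\<lambda>t. f t ^ r)"
  by (induction r) (auto intro: trig_poly_const trig_poly_mult)

lemma trig_poly_sum:
  "(\<And>i. i \<in> I \<Longrightarrow> trig_poly d (f i)) \<Longrightarrow> trig_poly d (\<lambda>t. \<Sum>i\<in>I. f i t)"
  by (induction I rule: infinite_finite_induct) (auto intro: trig_poly_const trig_poly.add)

lemma trig_poly_cmult: "trig_poly d f \<Longrightarrow> trig_poly d (\<lambda>t. c * f t)"
  using trig_poly_mult[OF trig_poly_const[of 0 c]] by simp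

lemma has_integral_cis:
  "((\<lambda>t. cis (2 * pi * of_int a * t)) has_integral (if a = 0 then 1 else 0)) {0..1}"
proof (cases "a = 0")
  case False
  define w where "w = \<i> * of_real (2 * pi * of_int a)"
  have w0: "w \<noteq> 0" using False by (simp add: w_def)
  have cis_w: "cis (2 * pi * of_int a * t) = exp (w * of_real t)" for t
    by (simp add: cis_conv_exp w_def mult.assoc)
  have "((\<lambda>z. exp (w * z) / w) has_field_derivative exp (w * of_real t)) (at (of_real t))" for t
    using w0 by (auto intro!: derivative_eq_intros)
  then have "((\<lambda>t. exp (w * of_real t)) has_integral (exp (w * of_real 1) / w - exp (w * of_real 0) / w)) {0..1}"
    by (intro fundamental_theorem_of_calculus has_vector_derivative_real_field) auto
  moreover have "exp (w * of_real 1) = cis (2 * pi * of_int a)" using cis_w[of 1] by simp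
  moreover have "cis (2 * pi * of_int a) = 1" by (intro cis_multiple_2pi) auto
  ultimately show ?thesis using False by (simp add: cis_w)
qed (use has_integral_const_real[of "1::complex" 0 1] in simp)

text \<open>
  Only the constant monomial has a frequency that is divisible by \<open>n > d\<close>; all others contribute
  \<open>0\<close> to the sum and to the integral.
\<close>

lemma trig_poly_quadrature:
  assumes "trig_poly d f" "d < n"
  shows "((\<lambda>t. of_nat n * f t) has_integral (\<Sum>j<n. f ((real j + \<alpha>) / real n))) {0..1}"
  using assms(1)
proof (induction rule: trig_poly.induct)
  case (monomial a c)
  have "int n dvd a \<longleftrightarrow> a = 0" using monomial assms(2) dvd_imp_le_int[of a "int n"] by fastforce
  then have "(\<Sum>j<n. c * cis (2 * pi * of_int a * ((real j + \<alpha>) / real n))) = of_nat n * (c * (if a = 0 then 1 else 0))"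
    using assms(2) unfolding sum_distrib_left[symmetric] by (subst sum_cis_equispaced) auto
  then show ?case
    using has_integral_mult_right[OF has_integral_mult_right[OF has_integral_cis]] by simp
next
  case (add f g)
  then show ?case using has_integral_add[OF add.IH] by (simp add: sum.distrib algebra_simps)
qed

text \<open>
  The tail of the logarithm series is dominated by a geometric series.  The summand for
  \<open>r = 0\<close> is \<open>0\<close>, since division by \<open>0\<close> yields \<open>0\<close>.
\<close>

lemma ln_one_minus_partial_sum:
  fixes x q :: real
  assumes "\<bar>x\<bar> \<le> q" "q < 1"
  shows "\<bar>ln (1 - x) - (\<Sum>r<N. - (x ^ r / real r))\<bar> \<le> q ^ N / (1 - q)"
proof -
  have x1: "\<bar>x\<bar> < 1" and q0: "0 \<le> q" using assms by auto
  have "(\<lambda>r. - (x ^ r / real r)) sums ln (1 - x)"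
    using ln_series'[of "- x"] x1 by simp
  then have "(\<lambda>r. - (x ^ (r + N) / real (r + N))) sums (ln (1 - x) - (\<Sum>r<N. - (x ^ r / real r)))"
    by (rule sums_split_initial_segment)
  then have eq: "ln (1 - x) - (\<Sum>r<N. - (x ^ r / real r)) = suminf (\<lambda>r. - (x ^ (r + N) / real (r + N)))"
    by (simp add: sums_iff)
  have geo: "(\<lambda>r. q ^ N * q ^ r) sums (q ^ N * (1 / (1 - q)))"
    using assms q0 by (intro sums_mult geometric_sums) auto
  have div_nat: "a / real k \<le> a" if "0 \<le> a" for a :: real and k
    using that by (cases k) (auto simp: field_simps)
  have bound: "norm (- (x ^ (r + N) / real (r + N))) \<le> q ^ N * q ^ r" for r
  proof -
    have "norm (- (x ^ (r + N) / real (r + N))) = \<bar>x\<bar> ^ (r + N) / real (r + N)"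
      by (simp add: power_abs)
    also have "\<dots> \<le> \<bar>x\<bar> ^ (r + N)"
      by (rule div_nat) simp
    also have "\<dots> \<le> q ^ (r + N)" using assms by (intro power_mono) auto
    finally show ?thesis by (simp add: power_add mult.commute)
  qed
  have "norm (suminf (\<lambda>r. - (x ^ (r + N) / real (r + N)))) \<le> suminf (\<lambda>r. q ^ N * q ^ r)"
    using bound geo by (intro norm_suminf_le) (auto simp: sums_iff)
  then show ?thesis using eq geo by (simp add: sums_iff)
qed


text \<open>
  The partial sum \<open>p N\<close> of the series of \<open>ln (a - S) = ln a + ln (1 - S / a)\<close> has degree at most
  \<open>N d\<close> and is within \<open>O(q\<^sup>N)\<close> of the logarithm.  For \<open>N d < n\<close> the quadrature of \<open>p N\<close>
  is exact, so that \<open>n\<close> times the error of the Riemann sum is \<open>O(n q\<^sup>N)\<close>.  Taking \<open>N\<close>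
  proportional to \<open>n\<close> makes this tend to \<open>0\<close>.
\<close>

lemma equispaced_ln_tendsto_integral:
  fixes S :: "real \<Rightarrow> real"
  assumes S: "trig_poly d (\<lambda>t. of_real (S t))" and d: "d > 0"
    and bound: "\<And>t. \<bar>S t\<bar> \<le> b" and a: "b < a"
  shows "(\<lambda>n. (\<Sum>j<n. ln (a - S ((real j + \<alpha>) / real n))) -
           real n * integral {0..1} (\<lambda>t. ln (a - S t))) \<longlonglongrightarrow> 0"
proof -
  define g where "g t = ln (a - S t)" for t
  \<comment> \<open>The ratio must be below 1; the lower bound 1/2 keeps it positive, so that its real powers behave well.\<close>
  define q where "q = max (b / a) (1 / 2)"
  have b0: "0 \<le> b" using bound[of 0] by linarith
  have a0: "0 < a" using b0 a by linarith
  have q: "0 < q" "q < 1" using a0 a b0 by (auto simp: q_def)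
  have Sq: "\<bar>S t / a\<bar> \<le> q" for t
    using divide_right_mono[OF bound[of t], of a] a0 by (simp add: q_def le_max_iff_disj)
  define p where "p N t = ln a + (\<Sum>r<N. - ((S t / a) ^ r / real r))" for N t
  have gp: "\<bar>g t - p N t\<bar> \<le> q ^ N / (1 - q)" for N t
  proof -
    have "1 - S t / a > 0" using Sq[of t] q by linarith
    moreover have "a - S t = a * (1 - S t / a)" using a0 by (simp add: field_simps)
    ultimately have "g t = ln a + ln (1 - S t / a)" unfolding g_def using a0 by (simp add: ln_mult)
    then show ?thesis using ln_one_minus_partial_sum[OF Sq q(2), of t N] by (simp add: p_def)
  qed
  have trig_p: "trig_poly (N * d) (\<lambda>t. of_real (p N t))" for N
  proof -
    have Sa: "trig_poly d (\<lambda>t. of_real (S t / a))"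
      using trig_poly_cmult[OF S, of "of_real (1 / a)"] by simp
    have "trig_poly (N * d) (\<lambda>t. - of_real (1 / real r) * of_real (S t / a) ^ r)" if "r < N" for r
      using that d by (intro trig_poly_cmult trig_poly_mono[OF trig_poly_power[OF Sa]]) auto
    then have "trig_poly (N * d) (\<lambda>t. of_real (ln a) + (\<Sum>r<N. - of_real (1 / real r) * of_real (S t / a) ^ r))"
      by (intro trig_poly.add trig_poly_const trig_poly_sum) auto
    then show ?thesis by (simp add: p_def)
  qed
  have p_quad: "((\<lambda>t. real n * p N t) has_integral (\<Sum>j<n. p N ((real j + \<alpha>) / real n))) {0..1}"
    if "N * d < n" for n N
    using has_integral_Re[OF trig_poly_quadrature[OF trig_p that, of \<alpha>]] by simp
  have cont: "continuous_on {0..1} g"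
  proof -
    have "continuous_on UNIV (\<lambda>t. complex_of_real (S t))" using S
      by (induction rule: trig_poly.induct) (auto intro!: continuous_intros)
    then have "continuous_on {0..1} S"
      using continuous_on_Re continuous_on_subset by fastforce
    moreover have "a - S t \<noteq> 0" for t using bound[of t] a by linarith
    ultimately show ?thesis unfolding g_def by (auto intro!: continuous_intros)
  qed
  then have g_int: "((\<lambda>t. real n * g t) has_integral (real n * integral {0..1} g)) {0..1}" for n
    by (intro has_integral_mult_right integrable_integral integrable_continuous_real)
  have bound_01: "norm I \<le> B" if "(f has_integral I) {0..1}" "0 \<le> B" "\<And>t. norm (f t) \<le> B"
    for f :: "real \<Rightarrow> real" and I B
    using has_integral_bound_real[of B "{}" f I 0 1] that by simp
  have err: "\<bar>(\<Sum>j<n. g ((real j + \<alpha>) / real n)) - real n * integral {0..1} g\<bar> \<le> 2 * real n * (q ^ N / (1 - q))"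
    if N: "N * d < n" for n N
  proof -
    have "((\<lambda>t. real n * g t - real n * p N t) has_integral
        (real n * integral {0..1} g - (\<Sum>j<n. p N ((real j + \<alpha>) / real n)))) {0..1}"
      by (intro has_integral_diff g_int p_quad N)
    then have "norm (real n * integral {0..1} g - (\<Sum>j<n. p N ((real j + \<alpha>) / real n)))
        \<le> real n * (q ^ N / (1 - q))"
    proof (rule bound_01)
      fix t :: real
      have "norm (real n * g t - real n * p N t) = real n * \<bar>g t - p N t\<bar>"
        by (simp add: abs_mult flip: right_diff_distrib)
      also have "\<dots> \<le> real n * (q ^ N / (1 - q))" using gp by (intro mult_left_mono) auto
      finally show "norm (real n * g t - real n * p N t) \<le> real n * (q ^ N / (1 - q))" .
    qed (use q in simp)
    moreover have "\<bar>(\<Sum>j<n. g ((real j + \<alpha>) / real n)) - (\<Sum>j<n. p N ((real j + \<alpha>) / real n))\<bar>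
        \<le> real n * (q ^ N / (1 - q))"
    proof -
      have "\<bar>\<Sum>j<n. g ((real j + \<alpha>) / real n) - p N ((real j + \<alpha>) / real n)\<bar> \<le> (\<Sum>j<n. q ^ N / (1 - q))"
        using gp by (intro order_trans[OF sum_abs] sum_mono) auto
      then show ?thesis by (simp add: sum_subtractf)
    qed
    ultimately show ?thesis by simp
  qed
  \<comment> \<open>The largest admissible number of terms is (n - 1) div d, and q to this power is at most (x ^ n) / q.\<close>
  define x where "x = q powr (1 / real d)"
  have x: "0 < x" "x < 1" using q d powr_less_mono2[of "1 / real d" q 1] by (auto simp: x_def)
  have "2 * real n * (q ^ ((n - 1) div d) / (1 - q)) \<le> 2 / (q * (1 - q)) * (real n * x ^ n)" for n
  proof -
    have "n \<le> d * Suc ((n - 1) div d)"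
      unfolding mult_Suc_right using mult_div_mod_eq[of d "n - 1"] mod_less_divisor[OF d, of "n - 1"] by linarith
    then have "real n \<le> real d * real (Suc ((n - 1) div d))" by (metis of_nat_le_iff of_nat_mult)
    then have "real n / real d \<le> real (Suc ((n - 1) div d))" using d by (simp add: divide_le_eq mult.commute)
    then have "q powr real (Suc ((n - 1) div d)) \<le> q powr (real n / real d)"
      using q by (intro powr_mono') auto
    also have "\<dots> = x ^ n" using q by (simp add: x_def powr_powr flip: powr_realpow)
    finally have "q ^ Suc ((n - 1) div d) \<le> x ^ n" using q by (simp only: powr_realpow)
    then have "q ^ ((n - 1) div d) \<le> x ^ n / q" using q by (simp add: field_simps)
    then have "2 * real n * (q ^ ((n - 1) div d) / (1 - q)) \<le> 2 * real n * ((x ^ n / q) / (1 - q))"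
      using q by (intro mult_left_mono divide_right_mono) auto
    then show ?thesis by (simp add: field_simps)
  qed
  moreover have "((n - 1) div d) * d < n" if "n \<ge> 1" for n
    using that div_times_less_eq_dividend[of "n - 1" d] by linarith
  ultimately have "\<forall>\<^sub>F n in sequentially. norm ((\<Sum>j<n. g ((real j + \<alpha>) / real n)) - real n * integral {0..1} g)
      \<le> 2 / (q * (1 - q)) * (real n * x ^ n)"
    using err by (intro eventually_sequentiallyI[of 1]) (fastforce intro: order_trans)
  moreover have "(\<lambda>n. 2 / (q * (1 - q)) * (real n * x ^ n)) \<longlonglongrightarrow> 0"
    using x by (intro tendsto_mult_right_zero powser_times_n_limit_0) simp
  ultimately have "(\<lambda>n. (\<Sum>j<n. g ((real j + \<alpha>) / real n)) - real n * integral {0..1} g) \<longlonglongrightarrow> 0"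
    by (rule Lim_null_comparison)
  then show ?thesis by (simp add: g_def[abs_def])
qed

section \<open>Evaluation of Laurent polynomials\<close>

text \<open>
  Sums over a common superset of the supports make evaluation additive.
\<close>

lemma laurent_eval_superset:
  assumes "finite A" "Poly_Mapping.keys R \<subseteq> A"
  shows "laurent_eval R z = (\<Sum>j\<in>A. Poly_Mapping.lookup R j * z powi j)"
  unfolding laurent_eval_def using assms
  by (intro sum.mono_neutral_left) (auto simp: in_keys_iff)

lemma laurent_eval_add: "laurent_eval (R + Q) z = laurent_eval R z + laurent_eval Q z"
proof -
  let ?A = "Poly_Mapping.keys R \<union> Poly_Mapping.keys Q"
  have "Poly_Mapping.keys (R + Q) \<subseteq> ?A" by (rule keys_add)
  then show ?thesis
    by (simp add: laurent_eval_superset[of ?A] lookup_add distrib_right sum.distrib)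
qed

lemma laurent_eval_zero: "laurent_eval 0 z = 0"
  by (simp add: laurent_eval_def)

lemma laurent_eval_diff: "laurent_eval (R - Q) z = laurent_eval R z - laurent_eval Q z"
  using laurent_eval_add[of "R - Q" Q z] by simp

lemma laurent_eval_sum: "laurent_eval (\<Sum>i\<in>I. R i) z = (\<Sum>i\<in>I. laurent_eval (R i) z)"
  by (induction I rule: infinite_finite_induct) (auto simp: laurent_eval_zero laurent_eval_add)

lemma laurent_eval_single: "laurent_eval (Poly_Mapping.single j c) z = c * z powi j"
  by (simp add: laurent_eval_def)

lemma laurent_eval_one: "laurent_eval 1 z = 1"
  using laurent_eval_single[of 0 1 z] by simp

lemma laurent_eval_mult:
  assumes "z \<noteq> 0"
  shows "laurent_eval (R * Q) z = laurent_eval R z * laurent_eval Q z"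
proof -
  have sum_single: "F = (\<Sum>j\<in>Poly_Mapping.keys F. Poly_Mapping.single j (Poly_Mapping.lookup F j))" for F :: laurent
    by (rule poly_mapping_eqI)
       (simp add: lookup_sum lookup_single when_def sum.delta in_keys_iff)
  have "R * Q = (\<Sum>i\<in>Poly_Mapping.keys R. \<Sum>j\<in>Poly_Mapping.keys Q.
      Poly_Mapping.single (i + j) (Poly_Mapping.lookup R i * Poly_Mapping.lookup Q j))"
    by (subst sum_single[of R], subst sum_single[of Q]) (simp add: sum_product mult_single)
  then have "laurent_eval (R * Q) z = (\<Sum>i\<in>Poly_Mapping.keys R. \<Sum>j\<in>Poly_Mapping.keys Q.
      (Poly_Mapping.lookup R i * Poly_Mapping.lookup Q j) * z powi (i + j))"
    by (simp add: laurent_eval_sum laurent_eval_single)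
  also have "\<dots> = (\<Sum>i\<in>Poly_Mapping.keys R. \<Sum>j\<in>Poly_Mapping.keys Q.
      (Poly_Mapping.lookup R i * z powi i) * (Poly_Mapping.lookup Q j * z powi j))"
    using assms by (simp add: power_int_add mult_ac)
  also have "\<dots> = laurent_eval R z * laurent_eval Q z"
    by (simp add: laurent_eval_def sum_product)
  finally show ?thesis .
qed

section \<open>Asymptotics of the number of rooted spanning forests\<close>

definition jump_cos :: "nat \<Rightarrow> (nat \<Rightarrow> nat) \<Rightarrow> real \<Rightarrow> real" where
  "jump_cos k s t = (\<Sum>i = 1..k. 2 * cos (2 * pi * real (s i) * t))"

lemma jump_cos_conv_cis:
  "complex_of_real (jump_cos k s t) =
     (\<Sum>i = 1..k. cis (2 * pi * of_int (int (s i)) * t) + cis (2 * pi * of_int (- int (s i)) * t))"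
proof -
  have "complex_of_real (2 * cos x) = cis x + cis (- x)" for x by (simp add: complex_eq_iff)
  then show ?thesis by (simp add: jump_cos_def)
qed

lemma abs_jump_cos_le: "\<bar>jump_cos k s t\<bar> \<le> 2 * real k"
proof -
  have "\<bar>jump_cos k s t\<bar> \<le> (\<Sum>i = 1..k. 2)"
    unfolding jump_cos_def by (intro order_trans[OF sum_abs] sum_mono) (simp add: abs_mult)
  then show ?thesis by simp
qed

lemma laurent_eval_jump_laurent:
  "laurent_eval (jump_laurent k s) (cis (2 * pi * t)) = of_real (2 * real k + 2 - jump_cos k s t)"
proof -
  have "cis (2 * pi * t) powi j = cis (2 * pi * of_int j * t)" for j
    by (simp add: cis_power_int algebra_simps)
  moreover have "cis (2 * pi * t) ^ i = cis (2 * pi * real i * t)" for i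
    by (simp add: Complex.DeMoivre algebra_simps)
  ultimately show ?thesis
    by (simp add: jump_laurent_def laurent_eval_diff laurent_eval_sum laurent_eval_add laurent_eval_single
          jump_cos_conv_cis del: of_real_sum)
qed

lemma trig_poly_jump_cos:
  assumes "\<And>i. i \<in> {1..k} \<Longrightarrow> s i \<le> d"
  shows "trig_poly d (\<lambda>t. of_real (jump_cos k s t))"
proof -
  have mono: "trig_poly d (\<lambda>t. cis (2 * pi * of_int a * t))" if "\<bar>a\<bar> \<le> int d" for a
    using trig_poly.monomial[OF that, of 1] by simp
  show ?thesis
    unfolding jump_cos_conv_cis using assms by (intro trig_poly_sum trig_poly.add mono) auto
qed

text \<open>
  The \<open>2 k + 1\<close> offsets are \<open>n\<close> and \<open>\<plusminus> s i\<close>.  The eigenvalue with index \<open>l\<close> contains the term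
  \<open>cis (\<pi> l) = (- 1) ^ l\<close> of the jump \<open>n\<close>, which is why even and odd indices are grouped
  separately.
\<close>

lemma card_rooted_spanning_forests_even_circulant:
  assumes s: "strict_mono_on {1..k} s" "\<And>i. i \<in> {1..k} \<Longrightarrow> 1 \<le> s i \<and> s i < n" and n: "n > 0"
  shows "real (card (rooted_spanning_forests (circulant (2 * n) (insert n (s ` {1..k}))))) =
    (\<Prod>j<n. (2 * real k + 1 - jump_cos k s (real j / real n)) *
            (2 * real k + 3 - jump_cos k s ((real j + 1 / 2) / real n)))"
proof -
  let ?T = "insert n (s ` {1..k})" and ?D = "circulant_offsets (2 * n) (insert n (s ` {1..k}))"
  let ?P = "(\<lambda>i. int (s i)) ` {1..k}" and ?N = "(\<lambda>i. - int (s i)) ` {1..k}"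
  define ev where "ev l = 2 * real k + 2 - (- 1) ^ l - jump_cos k s (real l / real (2 * n))" for l
  have inj: "inj_on s {1..k}" using s(1) by (rule strict_mono_on_imp_inj_on)
  have "n \<notin> s ` {1..k}" using s(2) by blast
  then have "{t \<in> ?T. 2 * t \<noteq> 2 * n} = s ` {1..k}"
    by auto
  then have D: "?D = insert (int n) (?P \<union> ?N)"
    by (simp add: circulant_offsets_def image_image)
  have neg: "d < 0" if "d \<in> ?N" for d
    using that
  proof (rule imageE)
    fix i assume "d = - int (s i)" "i \<in> {1..k}"
    then show ?thesis using s(2)[of i] by linarith
  qed
  have pos: "0 < d \<and> d < int n" if "d \<in> ?P" for d
    using that
  proof (rule imageE)
    fix i assume "d = int (s i)" "i \<in> {1..k}"
    then show ?thesis using s(2)[of i] by linarith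
  qed
  have fresh: "int n \<notin> ?P \<union> ?N" "?P \<inter> ?N = {}"
  proof -
    show "int n \<notin> ?P \<union> ?N" 
    proof
      assume "int n \<in> ?P \<union> ?N"
      then show False
      proof (rule UnE)
        assume "int n \<in> ?P"
        from pos[OF this] show False by simp
      next
        assume "int n \<in> ?N"
        from neg[OF this] show False by simp
      qed
    qed
    show "?P \<inter> ?N = {}" 
    proof (rule equals0I)
      fix d assume "d \<in> ?P \<inter> ?N"
      from pos[OF IntD1[OF this]] neg[OF IntD2[OF this]] show False by simp
    qed
  qed
  have injs: "inj_on (\<lambda>i. int (s i)) {1..k}" "inj_on (\<lambda>i. - int (s i)) {1..k}"
    using inj by (simp_all only: inj_on_def of_nat_eq_iff neg_equal_iff_equal)
  have sumD: "(\<Sum>d\<in>?D. f d) = f (int n) + (\<Sum>i = 1..k. f (int (s i)) + f (- int (s i)))"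
    for f :: "int \<Rightarrow> complex"
    unfolding D using fresh by (simp add: sum.union_disjoint sum.reindex[OF injs(1)] sum.reindex[OF injs(2)] sum.distrib
        del: One_nat_def)
  have cardD: "card ?D = 2 * k + 1"
    unfolding D using fresh by (simp add: card_Un_disjoint card_image[OF injs(1)] card_image[OF injs(2)] del: One_nat_def)
  have half: "cis (2 * pi * of_int (int n) * (real l / real (2 * n))) = (- 1) ^ l" for l
  proof -
    have "2 * pi * of_int (int n) * (real l / real (2 * n)) = real l * pi" using n by simp
    then show ?thesis by (simp flip: Complex.DeMoivre)
  qed
  have ev_even: "ev (2 * j) = 2 * real k + 1 - jump_cos k s (real j / real n)" for j
    by (simp add: ev_def)
  have ev_odd: "ev (2 * j + 1) = 2 * real k + 3 - jump_cos k s ((real j + 1 / 2) / real n)" for j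
  proof -
    have "real (2 * j + 1) / real (2 * n) = (real j + 1 / 2) / real n" using n by (simp add: field_simps)
    then show ?thesis unfolding ev_def by simp
  qed
  have "complex_of_nat (card (rooted_spanning_forests (circulant (2 * n) ?T))) =
      (\<Prod>l<2 * n. 1 + of_nat (card ?D) - (\<Sum>d\<in>?D. cis (2 * pi * of_int d * (real l / real (2 * n)))))"
    using s(2) n by (intro card_rooted_spanning_forests_circulant) (auto simp: less_imp_le)
  also have "\<dots> = (\<Prod>l<2 * n. of_real (ev l))"
    unfolding sumD half cardD jump_cos_conv_cis[symmetric] by (simp add: ev_def algebra_simps)
  finally have "of_real (real (card (rooted_spanning_forests (circulant (2 * n) ?T)))) = complex_of_real (\<Prod>l<2 * n. ev l)"
    by simp
  then have "real (card (rooted_spanning_forests (circulant (2 * n) ?T))) = (\<Prod>l<2 * n. ev l)"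
    by (simp only: of_real_eq_iff)
  also have "(\<Prod>l<2 * n. ev l) = (\<Prod>j<n. ev (2 * j) * ev (2 * j + 1))"
    by (induction n) (simp_all add: algebra_simps)
  finally show ?thesis by (simp only: ev_even ev_odd)
qed

theorem theorem6:
  fixes k :: nat and s :: "nat \<Rightarrow> nat"
  assumes "1 \<le> k"
    and "1 \<le> s 1"
    and "strict_mono_on {1..k} s"
  shows "let P = jump_laurent k s;
             K = mahler_measure ((P - 1) * (P + 1));
             f = (\<lambda>n. card (rooted_spanning_forests (circulant (2 * n) (insert n (s ` {1..k})))))
         in complex_of_real K =
              exp (integral {0..1} (\<lambda>t::real. ln ((laurent_eval P (cis (2 * pi * t)))\<^sup>2 - 1))) \<and>
            (\<lambda>n. real (f n)) \<sim>[at_top] (\<lambda>n. K ^ n)"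
proof -
  define P where "P = jump_laurent k s"
  define K where "K = mahler_measure ((P - 1) * (P + 1))"
  define f where "f n = card (rooted_spanning_forests (circulant (2 * n) (insert n (s ` {1..k}))))" for n
  define S where "S = jump_cos k s"
  define g1 where "g1 t = ln (2 * real k + 1 - S t)" for t
  define g2 where "g2 t = ln (2 * real k + 3 - S t)" for t
  have S_le: "\<bar>S t\<bar> \<le> 2 * real k" for t unfolding S_def by (rule abs_jump_cos_le)
  have pos: "2 * real k + 1 - S t > 0" "2 * real k + 3 - S t > 0" for t using S_le[of t] by linarith+
  have P_eval: "laurent_eval P (cis (2 * pi * t)) = of_real (2 * real k + 2 - S t)" for t
    unfolding P_def S_def by (rule laurent_eval_jump_laurent)
  have square: "(2 * real k + 2 - S t)\<^sup>2 - 1 = (2 * real k + 1 - S t) * (2 * real k + 3 - S t)" for t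
    by (simp add: power2_eq_square algebra_simps)
  have ln_square: "ln ((2 * real k + 2 - S t)\<^sup>2 - 1) = g1 t + g2 t" for t
    unfolding square g1_def g2_def using pos[of t] by (simp add: ln_mult)
  have "laurent_eval ((P - 1) * (P + 1)) (cis (2 * pi * t)) = of_real ((2 * real k + 2 - S t)\<^sup>2 - 1)" for t
  proof -
    have "laurent_eval ((P - 1) * (P + 1)) (cis (2 * pi * t)) =
        (laurent_eval P (cis (2 * pi * t)) - 1) * (laurent_eval P (cis (2 * pi * t)) + 1)"
      by (simp only: laurent_eval_mult[OF cis_neq_zero] laurent_eval_diff laurent_eval_add laurent_eval_one)
    also have "\<dots> = of_real ((2 * real k + 2 - S t)\<^sup>2 - 1)"
      unfolding P_eval square by (simp add: algebra_simps)
    finally show ?thesis .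
  qed
  moreover have pos_sq: "(2 * real k + 2 - S t)\<^sup>2 - 1 > 0" for t unfolding square using pos[of t] by simp
  ultimately have "ln (cmod (laurent_eval ((P - 1) * (P + 1)) (cis (2 * pi * t)))) = g1 t + g2 t" for t
    by (simp only: norm_of_real abs_of_pos ln_square)
  then have K: "K = exp (integral {0..1} (\<lambda>t. g1 t + g2 t))"
    unfolding K_def mahler_measure_def by simp
  have s_mono: "s i \<le> s j" if "i \<in> {1..k}" "j \<in> {1..k}" "i \<le> j" for i j
    using assms(3) that by (metis order_le_less strict_mono_onD)
  have s_ge: "1 \<le> s i" if "i \<in> {1..k}" for i using s_mono[of 1 i] that assms(1,2) by auto
  have trig: "trig_poly (s k) (\<lambda>t. of_real (S t))"
    unfolding S_def using s_mono by (intro trig_poly_jump_cos) auto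
  have sk: "s k > 0" using s_ge[of k] assms(1) by auto
  have cont: "continuous_on {0..1} g1" "continuous_on {0..1} g2"
    unfolding g1_def g2_def using pos
    by (auto simp: S_def jump_cos_def less_imp_neq[symmetric] intro!: continuous_intros)
  have int: "g1 integrable_on {0..1}" "g2 integrable_on {0..1}"
    using cont by (auto intro: integrable_continuous_real)
  have "ln ((laurent_eval P (cis (2 * pi * t)))\<^sup>2 - 1) = of_real (g1 t + g2 t)" for t
  proof -
    have "(laurent_eval P (cis (2 * pi * t)))\<^sup>2 - 1 = of_real ((2 * real k + 2 - S t)\<^sup>2 - 1)"
      unfolding P_eval by simp
    then show ?thesis using pos_sq[of t] by (simp only: Ln_of_real ln_square)
  qed
  moreover have "integral {0..1} (\<lambda>t. complex_of_real (g1 t + g2 t)) = of_real (integral {0..1} (\<lambda>t. g1 t + g2 t))"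
    by (intro integral_unique has_integral_of_real integrable_integral integrable_add int)
  ultimately have "complex_of_real K = exp (integral {0..1} (\<lambda>t. ln ((laurent_eval P (cis (2 * pi * t)))\<^sup>2 - 1)))"
    by (simp add: K exp_of_real)
  moreover have "(\<lambda>n. real (f n)) \<sim>[at_top] (\<lambda>n. K ^ n)"
  proof (rule asymp_equivI')
    \<comment> \<open>The logarithm of the quotient is the sum of the two scaled quadrature errors.\<close>
    let ?E1 = "\<lambda>n. (\<Sum>j<n. g1 ((real j + 0) / real n)) - real n * integral {0..1} g1"
    let ?E2 = "\<lambda>n. (\<Sum>j<n. g2 ((real j + 1 / 2) / real n)) - real n * integral {0..1} g2"
    have "?E1 \<longlonglongrightarrow> 0" unfolding g1_def using S_le
      by (intro equispaced_ln_tendsto_integral[OF trig sk]) auto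
    moreover have "?E2 \<longlonglongrightarrow> 0" unfolding g2_def using S_le
      by (intro equispaced_ln_tendsto_integral[OF trig sk]) auto
    ultimately have "(\<lambda>n. exp (?E1 n + ?E2 n)) \<longlonglongrightarrow> exp (0 + 0)"
      by (intro tendsto_exp tendsto_add)
    moreover have "exp (?E1 n + ?E2 n) = real (f n) / K ^ n" if n: "n > s k" for n
    proof -
      have "s i < n" if "i \<in> {1..k}" for i
        using s_mono[of i k] that n assms(1) by auto
      have "real (f n) = (\<Prod>j<n. exp (g1 ((real j + 0) / real n)) * exp (g2 ((real j + 1 / 2) / real n)))"
        unfolding f_def g1_def g2_def S_def[symmetric] using n pos s_ge \<open>\<And>i. i \<in> {1..k} \<Longrightarrow> s i < n\<close>
        by (subst card_rooted_spanning_forests_even_circulant[OF assms(3)]) (auto simp: S_def)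
      also have "\<dots> = exp ((\<Sum>j<n. g1 ((real j + 0) / real n)) + (\<Sum>j<n. g2 ((real j + 1 / 2) / real n)))"
        by (simp add: exp_sum exp_add prod.distrib)
      finally have "real (f n) = exp ((\<Sum>j<n. g1 ((real j + 0) / real n)) + (\<Sum>j<n. g2 ((real j + 1 / 2) / real n)))" .
      moreover have "K ^ n = exp (real n * integral {0..1} g1 + real n * integral {0..1} g2)"
        unfolding K by (simp add: integral_add[OF int] distrib_left flip: exp_of_nat_mult)
      ultimately show ?thesis by (simp add: algebra_simps flip: exp_diff)
    qed
    then have "\<forall>\<^sub>F n in sequentially. exp (?E1 n + ?E2 n) = real (f n) / K ^ n"
      by (rule eventually_mono[OF eventually_gt_at_top[of "s k"]])
    ultimately show "(\<lambda>n. real (f n) / K ^ n) \<longlonglongrightarrow> 1"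
      using Lim_transform_eventually by fastforce
  qed
  ultimately show ?thesis
    unfolding Let_def P_def K_def f_def by blast
qed

end
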